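(* Let $k$ be a non-negative integer and $p>5$ a prime. The monomial $X^d$ (with $d$ a non-negative integer) is planar over $\mathbb{F}_{p^{2^k}}$ if and only if $d\equiv 2p^i\pmod{p^{2^k}-1}$ for some non-negative integer $i$.
   Context: A polynomial is planar over $\mathbb{F}_q$ if the function $F$ it induces on $\mathbb{F}_q$ satisfies: for every non-zero $\alpha\in\mathbb{F}_q$, the map $x\mapsto F(x+\alpha)-F(x)-F(\alpha)$ is a permutation of $\mathbb{F}_q$. *)

theory Defs
  imports
    "HOL-Computational_Algebra.Polynomial"
    "HOL-Number_Theory.Cong"
    "HOL-Library.Cardinality"
begin

definition planar :: "'a :: {field, finite} poly \<Rightarrow> bool" where
  "planar f \<longleftrightarrow>
     (\<forall>\<alpha>. \<alpha> \<noteq> 0 \<longrightarrow> bij (\<lambda>x. poly f (x + \<alpha>) - poly f x - poly f \<alpha>))"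

end

theory Submission
  imports Defs
begin

text \<open>
  A planar monomial stays planar on every subfield, so one climbs the tower of quadratic extensions
  from \<open>F\<^sub>p\<close> to \<open>F\<^sub>q\<close>, \<open>q = p\<^bsup>2^k\<^esup>\<close>.

  \<^bold>\<open>Bottom.\<close>  Over \<open>F\<^sub>p\<close>, put \<open>\<phi>(x) = x\<^sup>d + b x\<close> and let \<open>M\<^sub>j\<close> be the \<open>j\<close>-th power sum of \<open>\<phi>\<close>.
  Planarity makes the sum of \<open>(\<phi>(u) - \<phi>(v))\<^bsup>2j\<^esup>\<close> over all pairs vanish, which by induction on \<open>j\<close>
  reduces to \<open>(2j choose j) M\<^sub>j\<^sup>2 = 0\<close>; hence \<open>M\<^sub>j = 0\<close> for \<open>j < (p - 1)/2\<close>. As this holds for all \<open>b\<close>,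
  no \<open>c + d i\<close> with \<open>0 < c + i < (p - 1)/2\<close> is divisible by \<open>p - 1\<close>, which leaves only \<open>d = 2\<close>
  and \<open>d = (p + 1)/2\<close>; the latter fails because some two consecutive non-zero elements are squares.

  \<^bold>\<open>Step.\<close>  Let \<open>d \<equiv> 2 (mod r - 1)\<close>, write \<open>d = 2 + m (r - 1)\<close>, \<open>A = m - 1\<close>, and let \<open>U\<close> be the group of
  \<open>(r + 1)\<close>-th roots of unity in \<open>F\<close> of order \<open>r\<^sup>2\<close>. On \<open>F\<^sub>r\<close> the monomial is \<open>x\<^sup>2\<close>, so the differences
  \<open>f(x + 1) - f(x)\<close> lying in \<open>F\<^sub>r\<close> are used up by \<open>x \<in> F\<^sub>r\<close>. In terms of \<open>v = x\<^bsup>r - 1\<^esup>\<close> this says that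
  \<open>h(v) = v (v\<^sup>A - v\<^bsup>-A\<^esup>) / (v - 1)\<^sup>2\<close> is injective on \<open>U - {1}\<close>, hence a bijection onto the
  line \<open>z\<^sup>r = -z\<close>, so all its power sums of exponent less than \<open>r - 1\<close> vanish. Evaluated, the even power sums are alternating
  sums of products of two binomial coefficients modulo \<open>p\<close>. The second one forces a representative
  \<open>a\<close> of \<open>\<plusminus>A\<close> modulo \<open>(r + 1)/2\<close> in the lower half to be \<open>0\<close> or \<open>1\<close> modulo \<open>p\<close>. If \<open>a \<noteq> 1\<close>, then for exponents
  \<open>Q - 1\<close> or \<open>Q - 3\<close>, with \<open>Q\<close> a power of \<open>p\<close> adapted to \<open>a\<close>, Lucas' theorem kills nearly all
  terms and the remainder is visibly non-zero; this is where \<open>p > 5\<close> enters. So \<open>A \<equiv> \<plusminus>1\<close> modulo \<open>(r + 1)/2\<close>, and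
  the case of the quadratic twist of \<open>x\<^sup>2\<close> is excluded by the sum of squares of its differences.
\<close>

subsection \<open>Binomial coefficients modulo a prime\<close>

lemma prime_dvd_choose_prime_power:
  fixes p :: nat
  assumes "prime p" "0 < j" "j < p ^ n"
  shows "p dvd (p ^ n choose j)"
proof (rule ccontr)
  assume "\<not> p dvd (p ^ n choose j)"
  then have "coprime (p ^ n) (p ^ n choose j)"
    using assms(1) by (simp add: prime_imp_coprime)
  moreover have "p ^ n dvd j * (p ^ n choose j)"
    using times_binomial_minus1_eq[of j "p ^ n"] assms(2) by simp
  ultimately have "p ^ n dvd j"
    by (simp add: coprime_dvd_mult_left_iff)
  then show False
    using assms(2,3) by (simp add: nat_dvd_not_less)
qed

text \<open>Vandermonde's identity for row \<open>Q + m\<close>: modulo \<open>p\<close> only the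
  two ends of row \<open>Q\<close> survive, that is, (1 + X)^Q = 1 + X^Q.\<close>

lemma choose_prime_power_add_cong:
  fixes p :: nat
  assumes "prime p" and Q: "Q = p ^ n"
  shows "[(Q + m) choose k = (m choose k) + (if Q \<le> k then m choose (k - Q) else 0)] (mod p)"
proof -
  have pos: "0 < Q" using assms by (simp add: prime_gt_0_nat)
  have "[(\<Sum>j\<le>k. (Q choose j) * (m choose (k - j)))
       = (\<Sum>j\<le>k. (if j = 0 then m choose k else 0) + (if j = Q then m choose (k - Q) else 0))] (mod p)"
  proof (rule cong_sum)
    fix j assume "j \<in> {..k}"
    show "[(Q choose j) * (m choose (k - j))
       = (if j = 0 then m choose k else 0) + (if j = Q then m choose (k - Q) else 0)] (mod p)"
    proof (cases "j = 0 \<or> j = Q")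
      case True
      then show ?thesis using pos by auto
    next
      case False
      then have "p dvd (Q choose j)"
        using prime_dvd_choose_prime_power[OF assms(1), of j n] Q
        by (cases "j < Q") (auto simp: binomial_eq_0)
      then show ?thesis using False by (simp add: cong_0_iff)
    qed
  qed
  also have "(\<Sum>j\<le>k. (Q choose j) * (m choose (k - j))) = (Q + m) choose k"
    by (rule vandermonde)
  also have "(\<Sum>j\<le>k. (if j = 0 then m choose k else 0) + (if j = Q then m choose (k - Q) else 0))
      = (m choose k) + (if Q \<le> k then m choose (k - Q) else 0)"
    by (simp add: sum.distrib)
  finally show ?thesis .
qed

lemma choose_lucas_low:
  fixes p :: nat
  assumes "prime p" and "Q = p ^ n" and "u < Q"
  shows "[(c + Q * m) choose u = c choose u] (mod p)"
proof (induction m)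
  case (Suc m)
  have "[(Q + (c + Q * m)) choose u = (c + Q * m) choose u] (mod p)"
    using choose_prime_power_add_cong[OF assms(1,2), of "c + Q * m" u] assms(3) by simp
  with Suc have "[(Q + (c + Q * m)) choose u = c choose u] (mod p)"
    using cong_trans by blast
  then show ?case by (simp add: algebra_simps)
qed simp

text \<open>Lucas' theorem for a lower index whose part above \<open>Q\<close> is 1: each further
  \<open>Q\<close> in the upper index adds one copy of \<open>c choose u\<close>, so
  \<open>m\<close> may exceed \<open>p\<close>. The condition \<open>c < Q\<close> makes the count
  start at zero.\<close>

lemma choose_lucas_carry:
  fixes p :: nat
  assumes "prime p" and "Q = p ^ n" and "u < Q" and "c < Q"
  shows "[(c + Q * m) choose (Q + u) = m * (c choose u)] (mod p)"
proof (induction m)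
  case 0
  then show ?case using assms by (simp add: binomial_eq_0)
next
  case (Suc m)
  have "[(Q + (c + Q * m)) choose (Q + u) = ((c + Q * m) choose (Q + u)) + ((c + Q * m) choose u)] (mod p)"
    using choose_prime_power_add_cong[OF assms(1,2), of "c + Q * m" "Q + u"] by simp
  also have "[((c + Q * m) choose (Q + u)) + ((c + Q * m) choose u) = m * (c choose u) + (c choose u)] (mod p)"
    by (intro cong_add Suc choose_lucas_low[OF assms(1-3)])
  finally show ?case by (simp add: algebra_simps)
qed

lemma choose_lucas_int:
  fixes p :: nat and K c m :: int
  assumes "prime p" and "Q = p ^ n" and "u < Q"
    and "0 \<le> K" and "K = c + int Q * m" and "0 \<le> c" and "c < int Q"
  shows "[int (nat K choose (Q + u)) = m * int (nat c choose u)] (mod int p)"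
proof -
  have "0 \<le> m"
  proof (rule ccontr)
    assume "\<not> 0 \<le> m"
    then have "int Q * m \<le> int Q * (-1)" by (intro mult_left_mono) auto
    then show False using assms by linarith
  qed
  then obtain m' where m: "m = int m'" using nonneg_int_cases by blast
  from assms(6) obtain c' where c: "c = int c'" using nonneg_int_cases by blast
  have "nat K = c' + Q * m'" using assms(5) unfolding m c by (metis nat_int of_nat_add of_nat_mult)
  moreover have "[(c' + Q * m') choose (Q + u) = m' * (c' choose u)] (mod p)"
    using assms c by (intro choose_lucas_carry) auto
  ultimately show ?thesis
    by (simp add: m c flip: cong_int_iff)
qed

text \<open>Modulo \<open>p\<close> one has (1 + X)^(Q - s) = (1 + X^Q) / (1 + X)^s, so below degree
  \<open>Q\<close> the coefficients are those of (1 + X)^(-s). This is the case s = 1; the next two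
  lemmas are s = 2 and s = 3, the last one doubled to avoid a division.\<close>

lemma choose_prime_power_minus_1:
  fixes p :: nat
  assumes "prime p" and "Q = p ^ n" and "i < Q"
  shows "[int ((Q - 1) choose i) = (-1) ^ i] (mod int p)"
  using assms(3)
proof (induction i)
  case (Suc i)
  have "Q choose Suc i = ((Q - 1) choose i) + ((Q - 1) choose Suc i)"
    using Suc.prems by (subst choose_reduce_nat) auto
  moreover have "p dvd (Q choose Suc i)"
    using prime_dvd_choose_prime_power[of p "Suc i" n] Suc.prems assms by simp
  ultimately have "[int ((Q - 1) choose i) + int ((Q - 1) choose Suc i) = 0] (mod int p)"
    by (metis cong_0_iff int_dvd_int_iff of_nat_add)
  moreover have "[int ((Q - 1) choose i) = (-1) ^ i] (mod int p)" using Suc by simp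
  ultimately have "[(int ((Q - 1) choose i) + int ((Q - 1) choose Suc i)) - int ((Q - 1) choose i) = 0 - (-1) ^ i] (mod int p)"
    by (rule cong_diff)
  then show ?case by simp
qed simp

lemma choose_prime_power_minus_2:
  fixes p :: nat
  assumes "prime p" and "Q = p ^ n" and "i + 1 < Q"
  shows "[int ((Q - 2) choose i) = (-1) ^ i * (int i + 1)] (mod int p)"
  using assms(3)
proof (induction i)
  case (Suc i)
  have "(Q - 1) choose Suc i = ((Q - 2) choose i) + ((Q - 2) choose Suc i)"
    using Suc.prems by (subst choose_reduce_nat) (auto simp: numeral_2_eq_2)
  then have "[int ((Q - 1) choose Suc i) - int ((Q - 2) choose i) = (-1) ^ Suc i - (-1) ^ i * (int i + 1)] (mod int p)"
    using Suc by (intro cong_diff choose_prime_power_minus_1[OF assms(1,2)]) auto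
  then show ?case
    using \<open>(Q - 1) choose Suc i = _\<close> by (simp add: algebra_simps)
qed simp

lemma choose_prime_power_minus_3:
  fixes p :: nat
  assumes "prime p" and "Q = p ^ n" and "i + 2 < Q"
  shows "[2 * int ((Q - 3) choose i) = (-1) ^ i * ((int i + 1) * (int i + 2))] (mod int p)"
  using assms(3)
proof (induction i)
  case (Suc i)
  have eq: "(Q - 2) choose Suc i = ((Q - 3) choose i) + ((Q - 3) choose Suc i)"
    using Suc.prems by (subst choose_reduce_nat) (auto simp: numeral_2_eq_2 numeral_3_eq_3)
  have "[2 * int ((Q - 2) choose Suc i) - 2 * int ((Q - 3) choose i)
      = 2 * ((-1) ^ Suc i * (int (Suc i) + 1)) - (-1) ^ i * ((int i + 1) * (int i + 2))] (mod int p)"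
    using Suc by (intro cong_diff cong_scalar_left choose_prime_power_minus_2[OF assms(1,2)]) auto
  then show ?case
    unfolding eq by (simp add: algebra_simps)
qed simp

subsection \<open>Alternating sums of binomial coefficients\<close>

text \<open>
  Up to sign, \<open>moment (r + 1) (2 A) t\<close> is the power sum of exponent \<open>2 t\<close> of \<open>h\<close>; the summation index
  is centred, i.e. \<open>k\<close> stands for the binomial index \<open>k + t\<close>.
\<close>

definition moment_term :: "int \<Rightarrow> int \<Rightarrow> nat \<Rightarrow> int \<Rightarrow> int" where
  "moment_term n b t k = (-1) ^ nat (k + int t) * int ((2 * t) choose nat (k + int t)) *
     int (nat ((2 * int t - 1 + b * k) mod n) choose (4 * t))"

definition moment :: "int \<Rightarrow> int \<Rightarrow> nat \<Rightarrow> int" where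
  "moment n b t = (\<Sum>k = - int t..int t. moment_term n b t k)"

lemma int_le_div_iff:
  fixes l n z :: int
  assumes "0 < n"
  shows "l \<le> z div n \<longleftrightarrow> l * n \<le> z"
proof
  assume "l \<le> z div n"
  then have "l * n \<le> (z div n) * n" using assms by simp
  also have "\<dots> \<le> z" using assms by (metis Euclidean_Rings.pos_mod_sign div_mult_mod_eq le_add_same_cancel1)
  finally show "l * n \<le> z" .
next
  assume "l * n \<le> z"
  then show "l \<le> z div n" using assms zdiv_mono1[of "l * n" z n] by simp
qed

lemma minus_one_power_square [simp]: "(-1 :: int) ^ i * (-1) ^ i = 1"
  by (metis left_minus_one_mult_self mult.right_neutral)

section \<open>Weights and last digits when \<open>2 * t\<close> is \<open>Q - 1\<close> or
  \<open>Q - 3\<close>\<close>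

lemma moment_weight_minus_1:
  fixes p :: nat
  assumes "prime p" "Q = p ^ n" "Q = 2 * t + 1" "k \<in> {- int t..int t}"
  shows "[(-1) ^ nat (k + int t) * int ((2 * t) choose nat (k + int t)) = 1] (mod int p)"
proof -
  let ?i = "nat (k + int t)"
  have "[int ((Q - 1) choose ?i) = (-1) ^ ?i] (mod int p)"
    using assms by (intro choose_prime_power_minus_1[of p Q n]) auto
  then have "[(-1) ^ ?i * int ((Q - 1) choose ?i) = (-1) ^ ?i * (-1) ^ ?i] (mod int p)"
    by (rule cong_scalar_left)
  then show ?thesis using assms(3) by simp
qed

text \<open>With i = k + (Q - 3)/2 the product (i + 1)(i + 2) equals ((2k + Q)^2 - 1)/4, so centring
  the index makes the weight an even polynomial in \<open>k\<close> modulo \<open>p\<close>. The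
  factor 8 clears denominators.\<close>

lemma moment_weight_minus_3:
  fixes p :: nat
  assumes "prime p" "Q = p ^ n" "Q = 2 * t + 3" "k \<in> {- int t..int t}" "n > 0"
  shows "[8 * ((-1) ^ nat (k + int t) * int ((2 * t) choose nat (k + int t))) = 4 * k\<^sup>2 - 1] (mod int p)"
proof -
  let ?i = "nat (k + int t)"
  have "[2 * int ((Q - 3) choose ?i) = (-1) ^ ?i * ((int ?i + 1) * (int ?i + 2))] (mod int p)"
    using assms by (intro choose_prime_power_minus_3[of p Q n]) auto
  then have "[(4 * (-1) ^ ?i) * (2 * int ((Q - 3) choose ?i))
      = (4 * (-1) ^ ?i) * ((-1) ^ ?i * ((int ?i + 1) * (int ?i + 2)))] (mod int p)"
    by (rule cong_scalar_left)
  also have "(4 * (-1) ^ ?i) * ((-1) ^ ?i * ((int ?i + 1) * (int ?i + 2)))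
      = 4 * (((-1) ^ ?i * (-1) ^ ?i) * ((int ?i + 1) * (int ?i + 2)))"
    by (simp only: mult_ac)
  also have "\<dots> = (4 * k\<^sup>2 - 1) + int Q * (int Q + 4 * k)"
    using assms(3,4) by (simp add: algebra_simps power2_eq_square)
  also have "[\<dots> = 4 * k\<^sup>2 - 1] (mod int p)"
  proof -
    have "int p dvd int Q" using assms(2,5) by simp
    then show ?thesis by (simp add: cong_iff_dvd_diff)
  qed
  finally show ?thesis using assms(3) by (simp add: mult_ac)
qed

lemma prime_power_ge_7:
  fixes p :: nat
  assumes "prime p" "p > 5" "n > 0"
  shows "p ^ n \<ge> 7"
proof -
  have "odd p" using assms by (intro prime_odd_nat) auto
  then have "p \<noteq> 6" by auto
  moreover have "p \<le> p ^ n" using assms by (simp add: self_le_power prime_gt_0_nat Suc_leI)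
  ultimately show ?thesis using assms(2) by linarith
qed

text \<open>Residue of \<open>(Q + x) choose (Q - 6)\<close> for negative \<open>x\<close>.\<close>

definition top_coeff :: "int \<Rightarrow> int" where
  "top_coeff x = (if x = -6 then 1 else if x = -5 then -5 else if x = -4 then 10
     else if x = -3 then -10 else if x = -2 then 5 else if x = -1 then -1 else 0)"

text \<open>For c = Q + x with x from -6 to -1, symmetry gives (Q + x) choose (x + 6), which modulo
  \<open>p\<close> is x choose (x + 6): the fifth row of Pascal's triangle with alternating signs.
  Smaller \<open>c\<close> give 0.\<close>

lemma top_coeff_cong:
  fixes p :: nat and c :: int
  assumes p: "prime p" "p > 5" and Q: "Q = p ^ n" "n > 0" and c: "0 \<le> c" "c < int Q"
  shows "[int (nat c choose (Q - 6)) = top_coeff (c - int Q)] (mod int p)"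
proof -
  have pQ: "p dvd Q" using Q by simp
  have Q7: "Q > 6" using prime_power_ge_7[OF p Q(2)] Q(1) by simp
  have "odd p" using p by (intro prime_odd_nat) auto
  then have odd2: "coprime 2 (int p)" by simp
  consider "c < int Q - 6" | "c = int Q - 6" | "c = int Q - 5" | "c = int Q - 4"
    | "c = int Q - 3" | "c = int Q - 2" | "c = int Q - 1" using c by linarith
  then show ?thesis
  proof cases
    case 1
    then have "nat c < Q - 6" using c by linarith
    then show ?thesis using 1 by (simp add: top_coeff_def binomial_eq_0)
  next
    case 2
    then have "nat c = Q - 6" using Q7 by linarith
    then show ?thesis using 2 by (simp add: top_coeff_def)
  next
    case 3
    then have "nat c = Suc (Q - 6)" using Q7 by linarith
    then have "int (nat c choose (Q - 6)) = int Q - 5" using Q7 by simp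
    then show ?thesis using 3 pQ by (simp add: top_coeff_def cong_iff_dvd_diff)
  next
    case 4
    then have eq: "nat c = Q - 4" using Q7 by linarith
    have "(Q - 4) choose (Q - 6) = (Q - 4) choose 2"
      using Q7 binomial_symmetric[of 2 "Q - 4"] by simp
    moreover have "2 * int ((Q - 4) choose 2) = (int Q - 4) * (int Q - 5)"
    proof -
      have "2 * ((Q - 4) choose 2) = (Q - 4) * (Q - 5)"
        using Q7 by (simp add: choose_two)
      then have "int (2 * ((Q - 4) choose 2)) = int ((Q - 4) * (Q - 5))" by presburger
      then show ?thesis using Q7 by (simp add: of_nat_diff)
    qed
    moreover have "[(int Q - 4) * (int Q - 5) = 2 * 10] (mod int p)"
    proof -
      have "(int Q - 4) * (int Q - 5) - 2 * 10 = int Q * (int Q - 9)" by (simp add: algebra_simps)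
      then show ?thesis using pQ by (simp add: cong_iff_dvd_diff)
    qed
    ultimately have "[2 * int (nat c choose (Q - 6)) = 2 * 10] (mod int p)"
      unfolding eq by simp
    then have "[int (nat c choose (Q - 6)) = 10] (mod int p)"
      by (simp only: cong_mult_lcancel[OF odd2])
    then show ?thesis using 4 by (simp add: top_coeff_def)
  next
    case 5
    then have eq: "nat c = Q - 3" using Q7 by linarith
    have "(Q - 3) choose (Q - 6) = (Q - 3) choose 3"
      using Q7 binomial_symmetric[of 3 "Q - 3"] by simp
    moreover have "[2 * int ((Q - 3) choose 3) = (-1) ^ 3 * ((int 3 + 1) * (int 3 + 2))] (mod int p)"
      using Q7 by (intro choose_prime_power_minus_3[OF p(1) Q(1)]) simp
    ultimately have "[2 * int (nat c choose (Q - 6)) = 2 * (- 10)] (mod int p)"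
      unfolding eq by simp
    then have "[int (nat c choose (Q - 6)) = - 10] (mod int p)"
      by (simp only: cong_mult_lcancel[OF odd2])
    then show ?thesis using 5 by (simp add: top_coeff_def)
  next
    case 6
    then have eq: "nat c = Q - 2" using Q7 by linarith
    have "(Q - 2) choose (Q - 6) = (Q - 2) choose 4"
      using Q7 binomial_symmetric[of 4 "Q - 2"] by simp
    moreover have "[int ((Q - 2) choose 4) = (-1) ^ 4 * (int 4 + 1)] (mod int p)"
      using Q7 by (intro choose_prime_power_minus_2[OF p(1) Q(1)]) simp
    ultimately show ?thesis unfolding eq using 6 by (simp add: top_coeff_def)
  next
    case 7
    then have eq: "nat c = Q - 1" using Q7 by linarith
    have "(Q - 1) choose (Q - 6) = (Q - 1) choose 5"
      using Q7 binomial_symmetric[of 5 "Q - 1"] by simp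
    moreover have "[int ((Q - 1) choose 5) = (-1) ^ 5] (mod int p)"
      using Q7 by (intro choose_prime_power_minus_1[OF p(1) Q(1)]) simp
    ultimately show ?thesis unfolding eq using 7 by (simp add: top_coeff_def)
  qed
qed

text \<open>Here \<open>4 * t\<close> is \<open>Q + (Q - 6)\<close>, so Lucas splits the second
  binomial into the multiplier \<open>m\<close> and a factor depending only on the last digit
  \<open>c\<close>, which is zero unless \<open>c\<close> is among the top six digits.\<close>

lemma moment_term_minus_3:
  fixes p :: nat and c m :: int
  assumes p: "prime p" "p > 5" and Q: "Q = p ^ w" "w > 0" "Q = 2 * t + 3"
    and k: "k \<in> {- int t..int t}" and n: "n > 0"
    and K: "(int Q - 4 + b * k) mod n = c + int Q * m" and c: "0 \<le> c" "c < int Q"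
  shows "[8 * moment_term n b t k = (4 * k\<^sup>2 - 1) * m * top_coeff (c - int Q)] (mod int p)"
proof -
  let ?K = "(int Q - 4 + b * k) mod n"
  have Q7: "Q \<ge> 7" using prime_power_ge_7[OF p Q(2)] Q(1) by simp
  have "[int (nat ?K choose (Q + (Q - 6))) = m * int (nat c choose (Q - 6))] (mod int p)"
    by (rule choose_lucas_int[OF p(1) Q(1)]) (use Q7 n c K in \<open>simp_all del: of_nat_diff flip: K\<close>)
  also have "[m * int (nat c choose (Q - 6)) = m * top_coeff (c - int Q)] (mod int p)"
    by (intro cong_scalar_left top_coeff_cong[OF p Q(1,2)] c)
  finally have "[8 * ((-1) ^ nat (k + int t) * int ((2 * t) choose nat (k + int t))) * int (nat ?K choose (Q + (Q - 6)))
      = (4 * k\<^sup>2 - 1) * (m * top_coeff (c - int Q))] (mod int p)"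
    by (intro cong_mult moment_weight_minus_3[OF p(1) Q(1) Q(3) k Q(2)])
  moreover have "Q + (Q - 6) = 4 * t" "int Q - 4 = 2 * int t - 1" using Q(3) Q7 by auto
  ultimately show ?thesis by (simp add: moment_term_def mult_ac)
qed


text \<open>This is the case a = 1 + P \<beta> with r = P \<rho>. Only k = 1, -1 and possibly k = 2,
  -2 survive, and the sum is, up to the factor 8, either 60 \<beta> or -60 \<beta>.\<close>

lemma moment_one_mod_prime_power:
  fixes p :: nat and \<beta> \<rho> :: int
  assumes p: "prime p" "p > 5" and P: "P = p ^ w" "w > 0" "P = 2 * t + 3"
    and rho: "int p dvd \<rho>" "odd \<rho>" and beta: "\<beta> > 0" "\<not> int p dvd \<beta>" "2 * \<beta> < \<rho>"
  shows "\<not> int p dvd moment (int P * \<rho> + 1) (2 * (1 + int P * \<beta>)) t"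
proof
  define n where "n = int P * \<rho> + 1"
  define b where "b = 2 * (1 + int P * \<beta>)"
  \<comment> \<open>Value of 8 times the \<open>k\<close>-th term: (4k^2 - 1) times 2 \<beta> k
    times the top coefficient. The latter is 5 and -5 at k = 1 and -1; at k = 2 and -2 it is -1 and
    1 if there is an additional wrap-around, and 0 otherwise.\<close>
  define g where "g k = (if k = -1 \<or> k = 1 then 30 * \<beta>
      else if (k = 2 \<or> k = -2) \<and> \<rho> < 4 * \<beta> then - 60 * \<beta> else 0)" for k :: int
  assume dvd: "int p dvd moment n b t"
  have P7: "P \<ge> 7" using prime_power_ge_7[OF p P(2)] P(1) by simp
  have n0: "n > 0" unfolding n_def using beta P7 by (simp add: add_pos_pos)
  have bn: "b \<le> n - int P + 1"
  proof -
    have "2 * \<beta> + 1 \<le> \<rho>" using beta by linarith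
    then have "int P * (2 * \<beta> + 1) \<le> int P * \<rho>" by (intro mult_left_mono) auto
    then show ?thesis by (simp add: b_def n_def algebra_simps)
  qed
  have bP: "b \<ge> 2 * int P + 2"
  proof -
    have "int P * 1 \<le> int P * \<beta>" using beta by (intro mult_left_mono) auto
    then show ?thesis by (simp add: b_def)
  qed
  \<comment> \<open>With \<open>W\<close> the number of wrap-arounds modulo \<open>n\<close>, Lucas' theorem requires the residue \<open>P - 4 + 2k - W\<close>
     modulo \<open>P\<close> to lie in the top six; as \<open>W\<close> is between \<open>0\<close> and \<open>k\<close>, this bounds \<open>k\<close>.\<close>
  have main: "[8 * moment_term n b t k = g k] (mod int p)" if k: "k \<in> {- int t..int t}" for k
  proof -
    define z where "z = int P - 4 + b * k"
    define W where "W = z div n"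
    define y where "y = int P - 4 + 2 * k - W"
    have le: "l \<le> W \<longleftrightarrow> l * n \<le> z" for l
      unfolding W_def by (rule int_le_div_iff[OF n0])
    have K: "z mod n = y + int P * (2 * \<beta> * k - W * \<rho>)"
    proof -
      have "z mod n = z - W * n" by (simp add: W_def minus_div_mult_eq_mod)
      then show ?thesis by (simp add: y_def z_def b_def n_def algebra_simps)
    qed
    have tP: "2 * int t = int P - 3" using P(3) by simp
    have kt: "- int P + 3 \<le> 2 * k" "2 * k \<le> int P - 3" using k tP by auto
    have Wpos: "0 \<le> W \<and> W \<le> k" if "0 \<le> k"
    proof -
      have "0 \<le> b * k" using that bP P7 by simp
      moreover have "b * k \<le> n * k" using that bn P7 by (intro mult_right_mono) auto
      ultimately show ?thesis
        using le[of 0] le[of "k + 1"] bn bP P7 unfolding z_def by (simp add: algebra_simps)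
    qed
    have Wneg: "k \<le> W \<and> W \<le> -1" if "k < 0"
    proof -
      have "b * k \<le> b * (-1)" using that bP P7 by (intro mult_left_mono) auto
      moreover have "n * k \<le> b * k" using that bn P7 by (intro mult_right_mono_neg) auto
      ultimately show ?thesis
        using le[of 0] le[of k] bn bP P7 unfolding z_def by (simp add: algebra_simps)
    qed
    have ylow: "0 \<le> y" "y \<le> 2 * int P - 7"
      using kt Wpos Wneg P7 unfolding y_def by (cases "k \<ge> 0"; linarith)+
    have val: "[8 * moment_term n b t k = (4 * k\<^sup>2 - 1) * (2 * \<beta> * k) * top_coeff (y - int P)] (mod int p)"
    proof (cases "y < int P")
      case True
      have "[8 * moment_term n b t k = (4 * k\<^sup>2 - 1) * (2 * \<beta> * k - W * \<rho>) * top_coeff (y - int P)] (mod int p)"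
        using K ylow True unfolding z_def by (intro moment_term_minus_3[OF p P k n0]) auto
      also have "[(4 * k\<^sup>2 - 1) * (2 * \<beta> * k - W * \<rho>) * top_coeff (y - int P)
          = (4 * k\<^sup>2 - 1) * (2 * \<beta> * k) * top_coeff (y - int P)] (mod int p)"
        using rho(1) by (intro cong_mult cong_refl) (simp add: cong_iff_dvd_diff)
      finally show ?thesis .
    next
      case False
      \<comment> \<open>If \<open>y\<close> reaches \<open>P\<close>, a carry leaves the last digit
        \<open>y - P\<close>, at most \<open>P - 7\<close>, hence below the top six: both sides are
        0.\<close>
      have "[8 * moment_term n b t k = (4 * k\<^sup>2 - 1) * (2 * \<beta> * k - W * \<rho> + 1) * top_coeff ((y - int P) - int P)] (mod int p)"
        using K ylow False unfolding z_def
        by (intro moment_term_minus_3[OF p P k n0]) (auto simp: algebra_simps)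
      then show ?thesis using ylow False by (simp add: top_coeff_def)
    qed
    have yP: "y - int P = 2 * k - W - 4" by (simp add: y_def)
    have cmp: "int P * \<rho> \<le> int P * (4 * \<beta> - 1) \<and> \<rho> < 4 * \<beta> \<or>
        int P * (4 * \<beta> + 1) \<le> int P * \<rho> \<and> \<not> \<rho> < 4 * \<beta>"
    proof -
      have "\<rho> \<noteq> 4 * \<beta>" using rho(2) by auto
      then show ?thesis by (cases "\<rho> < 4 * \<beta>") (auto intro!: mult_left_mono)
    qed
    consider "k \<le> -3" | "k = -2" | "k = -1" | "k = 0" | "k = 1" | "k = 2" | "k = 3" | "k \<ge> 4"
      by linarith
    then show ?thesis
    proof cases
      case 1
      then have "y - int P \<le> -7" using Wneg yP by linarith
      then have "top_coeff (y - int P) = 0" by (simp add: top_coeff_def)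
      then show ?thesis using val 1 by (simp add: g_def)
    next
      case 2
      have "\<rho> < 4 * \<beta> \<longleftrightarrow> W = -2"
        using 2 Wneg le[of "-1"] cmp P7 by (auto simp: z_def b_def n_def algebra_simps)
      moreover have "W = -1 \<or> W = -2" using 2 Wneg by auto
      ultimately show ?thesis using val yP 2 by (auto simp: g_def top_coeff_def)
    next
      case 3
      then have "W = -1" using Wneg by auto
      then show ?thesis using val yP 3 by (simp add: g_def top_coeff_def)
    next
      case 4
      then show ?thesis using val by (simp add: g_def)
    next
      case 5
      then have "W = 0" using Wpos le[of 1] bn unfolding z_def by auto
      then show ?thesis using val yP 5 by (simp add: g_def top_coeff_def)
    next
      case 6
      have "W = 0 \<or> W = 1" using 6 Wpos le[of 2] bn P7 unfolding z_def by auto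
      moreover have "\<rho> < 4 * \<beta> \<longleftrightarrow> W = 1"
        using 6 calculation le[of 1] cmp P7 by (auto simp: z_def b_def n_def algebra_simps)
      ultimately show ?thesis using val yP 6 by (auto simp: g_def top_coeff_def)
    next
      case 7
      then have "W \<le> 2" using le[of 3] bn P7 unfolding z_def by auto
      then have "top_coeff (y - int P) = 0" using 7 yP by (simp add: top_coeff_def)
      then show ?thesis using val 7 by (simp add: g_def)
    next
      case 8
      then have "y - int P \<ge> 0" using Wpos yP by linarith
      then have "top_coeff (y - int P) = 0" by (simp add: top_coeff_def)
      then show ?thesis using val 8 by (simp add: g_def)
    qed
  qed
  have "[8 * moment n b t = (\<Sum>k = - int t..int t. g k)] (mod int p)"
    unfolding moment_def sum_distrib_left by (intro cong_sum main)
  moreover have "(\<Sum>k = - int t..int t. g k) = (\<Sum>k\<in>{-2,-1,1,2}. g k)"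
    using P7 P(3) by (intro sum.mono_neutral_right) (auto simp: g_def)
  moreover have "\<dots> = 60 * \<beta> \<or> \<dots> = - 60 * \<beta>"
    by (simp add: g_def)
  ultimately have "int p dvd 60 * \<beta>"
    using dvd by (metis cong_dvd_iff dvd_minus_iff dvd_mult mult_minus_left)
  \<comment> \<open>The prime divisors of 60 are 2, 3 and 5; this uses \<open>p > 5\<close> in
    full.\<close>
  moreover have "\<not> int p dvd 60"
  proof
    assume "int p dvd 60"
    then have "p dvd 60" by (metis int_dvd_int_iff of_nat_numeral)
    moreover have "(60 :: nat) = 2 * (2 * (3 * 5))" by simp
    ultimately have "p dvd 2 * (2 * (3 * 5))" by (simp only:)
    then have "p dvd 2 \<or> p dvd 3 \<or> p dvd 5" unfolding prime_dvd_mult_iff[OF p(1)] by blast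
    then show False using p(2) by (auto dest!: dvd_imp_le)
  qed
  ultimately show False using p(1) beta(2) by (simp add: prime_dvd_mult_iff)
qed

section \<open>Moments for multiples of \<open>p\<close>\<close>

lemma sum_abs_symmetric_interval: "(\<Sum>x = - int M..int M. \<bar>x\<bar>) = int M * (int M + 1)"
proof (induction M)
  case (Suc M)
  have "{- int (Suc M)..int (Suc M)} = insert (int M + 1) (insert (- int M - 1) {- int M..int M})" by auto
  then show ?case using Suc by (simp add: algebra_simps)
qed simp

lemma top_choose_minus_2:
  fixes p :: nat and c :: int
  assumes p: "prime p" and Q: "Q = p ^ n" "n > 0" "Q > 2" and c: "0 \<le> c" "c < int Q"
  shows "[int (nat c choose (Q - 2)) = (if c = int Q - 2 then 1 else if c = int Q - 1 then -1 else 0)] (mod int p)"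
proof -
  consider "c < int Q - 2" | "c = int Q - 2" | "c = int Q - 1" using c by linarith
  then show ?thesis
  proof cases
    case 1
    then have "nat c < Q - 2" using c by linarith
    then show ?thesis using 1 by (simp add: binomial_eq_0)
  next
    case 2
    then have "nat c = Q - 2" using Q by linarith
    then show ?thesis using 2 by simp
  next
    case 3
    then have "nat c = Suc (Q - 2)" using Q by linarith
    then have "int (nat c choose (Q - 2)) = int Q - 1" using Q by simp
    then show ?thesis using 3 Q by (simp add: cong_iff_dvd_diff)
  qed
qed

lemma moment_term_minus_1:
  fixes p :: nat and c m :: int
  assumes p: "prime p" and Q: "Q = p ^ w" "w > 0" "Q = 2 * t + 1" "Q > 2"
    and k: "k \<in> {- int t..int t}" and n: "n > 0"
    and K: "(int Q - 2 + b * k) mod n = c + int Q * m" and c: "0 \<le> c" "c < int Q"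
  shows "[moment_term n b t k = m * (if c = int Q - 2 then 1 else if c = int Q - 1 then -1 else 0)] (mod int p)"
proof -
  let ?K = "(int Q - 2 + b * k) mod n" and ?v = "if c = int Q - 2 then 1 else if c = int Q - 1 then -1 else 0 :: int"
  have "[int (nat ?K choose (Q + (Q - 2))) = m * int (nat c choose (Q - 2))] (mod int p)"
    by (rule choose_lucas_int[OF p Q(1)]) (use Q(4) n c K in \<open>simp_all del: of_nat_diff flip: K\<close>)
  also have "[m * int (nat c choose (Q - 2)) = m * ?v] (mod int p)"
    by (intro cong_scalar_left top_choose_minus_2[OF p Q(1,2,4)] c)
  finally have "[((-1) ^ nat (k + int t) * int ((2 * t) choose nat (k + int t))) * int (nat ?K choose (Q + (Q - 2)))
      = 1 * (m * ?v)] (mod int p)"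
    by (intro cong_mult moment_weight_minus_1[OF p Q(1) Q(3) k])
  moreover have "Q + (Q - 2) = 4 * t" "int Q - 2 = 2 * int t - 1" using Q(3,4) by auto
  ultimately show ?thesis unfolding moment_term_def by (simp only: mult_1)
qed

text \<open>This is the case a = P \<alpha> with r = P J \<rho> and 2t = P J - 1. The surviving
  indices are k = J x with |x| at most \<open>M\<close>, each contributing 2 \<alpha> |x|, so the
  total is 2 \<alpha> M (M + 1). The hypothesis \<open>bound\<close> keeps \<open>M\<close> and
  \<open>M + 1\<close> strictly between 0 and \<open>p\<close>.\<close>

lemma moment_zero_mod_prime_power_low:
  fixes p :: nat and \<alpha> \<rho> :: int
  assumes p: "prime p" "p > 5" and P: "P = p ^ w" "w > 0" and J: "J = p ^ j" and Q: "P * J = 2 * t + 1"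
    and rho: "int p dvd \<rho>" "odd \<rho>" and alpha: "\<alpha> > 0" "\<not> int p dvd \<alpha>" "2 * \<alpha> < \<rho>"
    and bound: "P = p \<or> \<rho> < 2 * \<alpha> * (int p - 1)"
  shows "\<not> int p dvd moment (int (P * J) * \<rho> + 1) (2 * int P * \<alpha>) t"
proof
  define Q where "Q = P * J"
  define n where "n = int Q * \<rho> + 1"
  define b where "b = 2 * int P * \<alpha>"
  define S where "S = {k \<in> {- int t..int t}. int J dvd k \<and> 2 * \<alpha> * \<bar>k\<bar> < int J * \<rho>}"
  define g where "g k = (if k \<in> S then 2 * \<alpha> * (\<bar>k\<bar> div int J) else 0)" for k :: int
  assume dvd: "int p dvd moment n b t"
  have Qp: "Q = p ^ (w + j)" "w + j > 0" "Q = 2 * t + 1" using P J Q by (auto simp: Q_def power_add)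
  have P7: "P \<ge> 7" using prime_power_ge_7[OF p P(2)] P(1) by simp
  have J0: "J > 0" using J p by (simp add: prime_gt_0_nat)
  have odd: "odd P" using Q by (metis even_mult_iff odd_two_times_div_two_succ even_plus_one_iff dvd_triv_left)
  have Q7: "Q \<ge> 7" using prime_power_ge_7[OF p Qp(2)] Qp(1) by simp
  have rho1: "\<rho> \<ge> 1" using alpha by linarith
  have n0: "n > 0" unfolding n_def using rho1 Q7 by (simp add: add_pos_pos)
  have cop: "coprime (int J) (2 * \<alpha>)"
  proof -
    have "odd p" using p by (intro prime_odd_nat) auto
    then have "coprime (int p) (2 * \<alpha>)"
      using p(1) alpha(2) by (simp add: prime_imp_coprime)
    then show ?thesis using J by simp
  qed
  \<comment> \<open>Here \<open>\<bar>W\<bar> < P\<close>, so only \<open>W = 0\<close> and \<open>W = -1\<close> survive, and then \<open>J\<close> divides \<open>k\<close>.\<close>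
  have main: "[moment_term n b t k = g k] (mod int p)" if k: "k \<in> {- int t..int t}" for k
  proof -
    define z where "z = int Q - 2 + b * k"
    define W where "W = z div n"
    have le: "l \<le> W \<longleftrightarrow> l * n \<le> z" for l
      unfolding W_def by (rule int_le_div_iff[OF n0])
    have K: "z mod n = z - W * n" by (simp add: W_def minus_div_mult_eq_mod)
    show ?thesis
    proof (cases "k \<in> S")
      case True
      then obtain x where x: "k = int J * x" unfolding S_def by auto
      have ax: "2 * \<alpha> * \<bar>x\<bar> < \<rho>"
        using True J0 unfolding S_def x by (simp add: abs_mult mult.left_commute[of _ "int J"] mult.assoc)
      have z: "z = int Q - 2 + int Q * (2 * \<alpha> * x)" unfolding z_def b_def x Q_def by (simp add: mult_ac)
      have kJ: "\<bar>k\<bar> div int J = \<bar>x\<bar>" using J0 x by (simp add: abs_mult)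
      show ?thesis
      proof (cases "x \<ge> 0")
        case xn: True
        have "int Q * (2 * \<alpha> * x + 1) \<le> int Q * \<rho>" using ax xn by (intro mult_left_mono) auto
        moreover have "0 \<le> int Q * (2 * \<alpha> * x)" using xn alpha by simp
        ultimately have "W = 0" using le[of 0] le[of 1] Q7 unfolding z n_def by (simp add: algebra_simps)
        then have "z mod n = (int Q - 2) + int Q * (2 * \<alpha> * x)" using K z by simp
        then have "[moment_term n b t k = (2 * \<alpha> * x) * 1] (mod int p)"
          using moment_term_minus_1[OF p(1) Qp _ k n0, of b "int Q - 2" "2 * \<alpha> * x"] Q7 unfolding z_def by simp
        then show ?thesis using True xn kJ by (simp add: g_def)
      next
        case xn: False
        have "int Q * (- \<rho>) \<le> int Q * (2 * \<alpha> * x)" using ax xn by (intro mult_left_mono) auto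
        moreover have "int Q * (2 * \<alpha> * x) \<le> int Q * (-1)"
        proof (intro mult_left_mono)
          have "2 * \<alpha> * x \<le> 2 * \<alpha> * (-1)" using xn alpha by (intro mult_left_mono) auto
          then show "2 * \<alpha> * x \<le> -1" using alpha by linarith
        qed auto
        ultimately have "W = -1" using le[of 0] le[of "-1"] Q7 unfolding z n_def by (simp add: algebra_simps)
        then have "z mod n = z + n" using K by simp
        \<comment> \<open>Wrapping once raises the last digit to \<open>Q - 1\<close>, whose sign is
          -1, and changes the multiplier by \<rho>, which is 0 modulo \<open>p\<close>; the net
          effect is the absolute value of \<open>x\<close>.\<close>
        also have "\<dots> = (int Q - 1) + int Q * (2 * \<alpha> * x + \<rho>)" unfolding z n_def by (simp add: algebra_simps)
        finally have "[moment_term n b t k = (2 * \<alpha> * x + \<rho>) * (-1)] (mod int p)"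
          using moment_term_minus_1[OF p(1) Qp _ k n0, of b "int Q - 1" "2 * \<alpha> * x + \<rho>"] Q7 unfolding z_def by simp
        also have "[(2 * \<alpha> * x + \<rho>) * (-1) = 2 * \<alpha> * \<bar>x\<bar>] (mod int p)"
          using xn rho(1) by (simp add: cong_iff_dvd_diff)
        finally show ?thesis using True kJ by (simp add: g_def)
      qed
    next
      case False
      define c where "c = (z mod n) mod int Q"
      define m where "m = (z mod n) div int Q"
      have cm: "z mod n = c + int Q * m" "0 \<le> c" "c < int Q"
        using Q7 by (auto simp: c_def m_def)
      have "\<not> (c = int Q - 2 \<or> c = int Q - 1)"
      proof
        assume c: "c = int Q - 2 \<or> c = int Q - 1"
        define \<delta> where "\<delta> = c - (int Q - 2)"
        have delta: "\<delta> = 0 \<or> \<delta> = 1" using c by (auto simp: \<delta>_def)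
        have eq: "2 * int P * \<alpha> * k - W - \<delta> = int Q * (m + W * \<rho>)"
          using cm(1) K unfolding z_def b_def n_def \<delta>_def by (simp add: algebra_simps)
        have "int P dvd 2 * int P * \<alpha> * k - (2 * int P * \<alpha> * k - W - \<delta>)"
          unfolding eq by (intro dvd_diff) (auto simp: Q_def)
        then have PW: "int P dvd W + \<delta>" by simp
        define X where "X = int Q * \<rho>"
        have X: "int Q \<le> X" unfolding X_def using rho1 Q7 by simp
        have PX: "7 * X \<le> int P * X" using P7 X Q7 by (intro mult_right_mono) auto
        have bk: "2 * \<bar>b * k\<bar> \<le> int P * X"
        proof -
          have "2 * \<bar>k\<bar> \<le> int Q" using k Qp(3) by auto
          then have "(2 * \<alpha>) * (2 * \<bar>k\<bar>) \<le> \<rho> * int Q" using alpha by (intro mult_mono) auto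
          then have "int P * ((2 * \<alpha>) * (2 * \<bar>k\<bar>)) \<le> int P * (\<rho> * int Q)" by (intro mult_left_mono) auto
          then show ?thesis using alpha by (simp add: b_def X_def abs_mult mult_ac)
        qed
        have "\<not> int P - 1 \<le> W"
          using le[of "int P - 1"] bk PX X P7 unfolding z_def n_def X_def[symmetric]
          by (simp add: algebra_simps abs_le_iff)
        moreover have "- int P + 1 \<le> W"
          using le[of "- int P + 1"] bk PX X P7 unfolding z_def n_def X_def[symmetric]
          by (simp add: algebra_simps abs_le_iff)
        ultimately have "\<bar>W + \<delta>\<bar> < int P" using delta by linarith
        then have W: "W = - \<delta>" using PW by (meson add_eq_0_iff2 zdvd_not_zless zero_less_abs_iff dvd_abs_iff)
        then have "int P * int J dvd int P * ((2 * \<alpha>) * k)"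
          using eq by (metis Q_def dvd_triv_left add.inverse_inverse diff_add_cancel diff_minus_eq_add mult.assoc mult.left_commute of_nat_mult)
        then have "int J dvd (2 * \<alpha>) * k" using P7 by simp
        then have "int J dvd k" using cop by (simp add: coprime_dvd_mult_right_iff)
        then obtain x where x: "k = int J * x" by auto
        have z: "z = int Q - 2 + int Q * (2 * \<alpha> * x)" unfolding z_def b_def x Q_def by (simp add: mult_ac)
        have "2 * \<alpha> * \<bar>x\<bar> < \<rho>"
        proof (cases "\<delta> = 0")
          case True
          then have "0 \<le> z" "z < n" using W le[of 0] le[of 1] by auto
          then have "int Q * 0 < int Q * (2 * \<alpha> * x + 1)" "int Q * (2 * \<alpha> * x + 1) < int Q * (\<rho> + 1)"
            using Q7 unfolding z n_def distrib_left by linarith+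
          then have "0 < 2 * \<alpha> * x + 1" "2 * \<alpha> * x + 1 < \<rho> + 1"
            using Q7 by (auto simp only: mult_less_cancel_left_pos of_nat_0_less_iff)
          moreover from this have "0 \<le> x" using alpha by (smt (verit) mult_neg_pos mult_pos_neg)
          ultimately show ?thesis by simp
        next
          case False
          then have "z < 0" "- n \<le> z" using W delta le[of 0] le[of "-1"] by auto
          then have "int Q * (2 * \<alpha> * x + 1) < int Q * 1" "int Q * 0 < int Q * (2 * \<alpha> * x + 1 + \<rho>)"
            using Q7 unfolding z n_def by (auto simp: algebra_simps)
          then have "2 * \<alpha> * x + 1 < 1" "0 < 2 * \<alpha> * x + 1 + \<rho>"
            using Q7 by (auto simp only: mult_less_cancel_left_pos of_nat_0_less_iff)
          moreover from this have "x < 0" using alpha by (smt (verit) mult_nonneg_nonneg)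
          moreover have "2 * \<alpha> * x \<noteq> - \<rho>" using rho(2) by (metis even_minus even_mult_iff even_numeral)
          ultimately show ?thesis by simp
        qed
        then have "2 * \<alpha> * \<bar>k\<bar> < int J * \<rho>" using J0 unfolding x by (simp add: abs_mult mult.left_commute[of _ "int J"] mult.assoc)
        then show False using False k \<open>int J dvd k\<close> by (simp add: S_def)
      qed
      then show ?thesis
        using moment_term_minus_1[OF p(1) Qp _ k n0, of b c m] cm Q7 False unfolding z_def g_def by auto
    qed
  qed
  \<comment> \<open>The two bounds come from the range of summation, |J x| \<le> t, and from 2
    \<alpha> |x| < \<rho>.\<close>
  define M where "M = min ((P - 1) div 2) (nat ((\<rho> - 1) div (2 * \<alpha>)))"
  have MR: "int M = min ((int P - 1) div 2) ((\<rho> - 1) div (2 * \<alpha>))"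
    using alpha P7 by (simp add: M_def min_def nat_le_iff zdiv_int of_nat_diff le_nat_iff pos_imp_zdiv_nonneg_iff)
  have S: "S = (\<lambda>x. int J * x) ` {- int M..int M}"
  proof -
    have iff: "int J * x \<in> S \<longleftrightarrow> \<bar>x\<bar> \<le> int M" for x
    proof -
      have "int J * x \<in> {- int t..int t} \<longleftrightarrow> \<bar>x\<bar> \<le> (int P - 1) div 2"
      proof -
        have "int J * x \<in> {- int t..int t} \<longleftrightarrow> int J * \<bar>x\<bar> \<le> int t"
        proof -
          have "\<bar>int J * x\<bar> = int J * \<bar>x\<bar>" by (simp add: abs_mult)
          then show ?thesis unfolding atLeastAtMost_iff by linarith
        qed
        also have "\<dots> \<longleftrightarrow> int J * (2 * \<bar>x\<bar>) < int J * int P"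
        proof -
          have "int J * int P = 2 * int t + 1" using arg_cong[OF Q, of int] by (simp add: mult.commute)
          moreover have "int J * (2 * \<bar>x\<bar>) = 2 * (int J * \<bar>x\<bar>)" by simp
          ultimately show ?thesis by linarith
        qed
        also have "\<dots> \<longleftrightarrow> 2 * \<bar>x\<bar> < int P" using J0 by simp
        also have "\<dots> \<longleftrightarrow> \<bar>x\<bar> \<le> (int P - 1) div 2" by linarith
        finally show ?thesis .
      qed
      moreover have "2 * \<alpha> * \<bar>int J * x\<bar> < int J * \<rho> \<longleftrightarrow> \<bar>x\<bar> \<le> (\<rho> - 1) div (2 * \<alpha>)"
      proof -
        have "2 * \<alpha> * \<bar>int J * x\<bar> < int J * \<rho> \<longleftrightarrow> 2 * \<alpha> * \<bar>x\<bar> < \<rho>"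
          using J0 by (simp add: abs_mult mult.left_commute[of _ "int J"] mult.assoc)
        also have "\<dots> \<longleftrightarrow> \<bar>x\<bar> \<le> (\<rho> - 1) div (2 * \<alpha>)"
          using alpha by (subst int_le_div_iff) (auto simp: mult_ac)
        finally show ?thesis .
      qed
      ultimately show ?thesis unfolding S_def MR by auto
    qed
    show ?thesis
    proof
      show "S \<subseteq> (\<lambda>x. int J * x) ` {- int M..int M}"
      proof
        fix k assume "k \<in> S"
        then obtain x where "k = int J * x" unfolding S_def by auto
        then show "k \<in> (\<lambda>x. int J * x) ` {- int M..int M}" using iff[of x] \<open>k \<in> S\<close> by (auto simp: abs_le_iff)
      qed
      show "(\<lambda>x. int J * x) ` {- int M..int M} \<subseteq> S"
      proof
        fix k assume "k \<in> (\<lambda>x. int J * x) ` {- int M..int M}"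
        then obtain x where x: "k = int J * x" "x \<in> {- int M..int M}" by blast
        then have "\<bar>x\<bar> \<le> int M" by auto
        then show "k \<in> S" using iff[of x] x(1) by blast
      qed
    qed
  qed
  have "[moment n b t = (\<Sum>k = - int t..int t. g k)] (mod int p)"
    unfolding moment_def by (intro cong_sum main)
  also have "(\<Sum>k = - int t..int t. g k) = (\<Sum>k\<in>S. 2 * \<alpha> * (\<bar>k\<bar> div int J))"
    unfolding g_def by (intro sum.mono_neutral_cong_right) (auto simp: S_def)
  also have "\<dots> = (\<Sum>x = - int M..int M. 2 * \<alpha> * \<bar>x\<bar>)"
    unfolding S using J0 by (subst sum.reindex) (auto simp: inj_on_def abs_mult)
  also have "\<dots> = 2 * \<alpha> * (int M * (int M + 1))"
    by (simp add: sum_abs_symmetric_interval flip: sum_distrib_left)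
  finally have "int p dvd 2 * \<alpha> * (int M * (int M + 1))"
    using dvd cong_dvd_iff by blast
  moreover have "\<not> int p dvd 2" using p(2) by (auto dest: zdvd_imp_le)
  moreover have "\<not> int p dvd int M \<and> \<not> int p dvd int M + 1"
  proof -
    have "1 \<le> int M" unfolding MR using alpha P7 by (simp add: int_le_div_iff)
    moreover have "int M \<le> int p - 2"
    proof (cases "P = p")
      case True
      then show ?thesis using p(2) unfolding MR by linarith
    next
      case False
      then have "\<not> int p - 1 \<le> (\<rho> - 1) div (2 * \<alpha>)"
        using bound alpha by (subst int_le_div_iff) (auto simp: mult_ac)
      then show ?thesis unfolding MR by linarith
    qed
    ultimately show ?thesis
      using zdvd_imp_le[of "int p" "int M"] zdvd_imp_le[of "int p" "int M + 1"] by linarith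
  qed
  moreover have "prime (int p)" using p(1) by simp
  ultimately show False
    using alpha(2) by (simp only: prime_dvd_mult_iff) blast
qed


text \<open>The same shape of a and r, now with 2t = P J - 3 and the ratio 2 \<alpha> / \<rho>
  between 1 and 7/6. For k = J x the number of wrap-arounds is x at x = 0, 1, 2 and x - 1 at x = -1,
  -2. As \<open>p\<close> divides \<open>J\<close>, 8 times the weight is -1, and the terms add up
  to 10 + 10 - 4 - 4 = 12 times \<alpha>.\<close>

lemma moment_zero_mod_prime_power_high:
  fixes p :: nat and \<alpha> \<rho> :: int
  assumes p: "prime p" "p > 5" and P: "P = p ^ w" "w > 1" and J: "J = p ^ j" "j > 0" and Q: "P * J = 2 * t + 3"
    and rho: "int p dvd \<rho>" and alpha: "\<alpha> > 0" "\<not> int p dvd \<alpha>" "\<rho> < 2 * \<alpha>" "12 * \<alpha> < 7 * \<rho>"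
  shows "\<not> int p dvd moment (int (P * J) * \<rho> + 1) (2 * int P * \<alpha>) t"
proof
  define Q where "Q = P * J"
  define n where "n = int Q * \<rho> + 1"
  define b where "b = 2 * int P * \<alpha>"
  define g where "g k = (if k = int J \<or> k = - int J then 10 * \<alpha>
      else if k = 2 * int J \<or> k = - 2 * int J then - 4 * \<alpha> else 0)" for k :: int
  assume dvd: "int p dvd moment n b t"
  have Qp: "Q = p ^ (w + j)" "w + j > 0" "Q = 2 * t + 3" using P J Q by (auto simp: Q_def power_add)
  have p7: "p \<ge> 7" using prime_power_ge_7[OF p, of 1] by simp
  have P16: "P \<ge> 16"
  proof -
    have "7 * 7 \<le> p * p" using p7 by (intro mult_mono) auto
    also have "p * p = p ^ 2" by (simp add: power2_eq_square)
    also have "\<dots> \<le> P" unfolding P(1) using P(2) p7 by (intro power_increasing) auto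
    finally show ?thesis by simp
  qed
  have J7: "J \<ge> 7" using prime_power_ge_7[OF p J(2)] J(1) by simp
  have pJ: "int p dvd int J" using J by simp
  have JQ: "16 * int J \<le> int Q" using P16 mult_right_mono[of 16 "int P" "int J"] unfolding Q_def by simp
  have rho7: "\<rho> \<ge> 7"
  proof -
    have "\<rho> > 0" using alpha by linarith
    then have "int p \<le> \<rho>" using rho by (simp add: zdvd_imp_le)
    then show ?thesis using p7 by linarith
  qed
  define X where "X = int Q * \<rho>"
  define Y where "Y = int Q * \<alpha>"
  have n0: "n > 0" unfolding n_def using rho7 by (simp add: add_nonneg_pos)
  have XQ: "7 * int Q \<le> X" unfolding X_def using rho7 mult_left_mono[of 7 \<rho> "int Q"] by simp
  have XY: "X + int Q \<le> 2 * Y" "12 * Y \<le> 7 * X"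
    using alpha mult_left_mono[of "\<rho> + 1" "2 * \<alpha>" "int Q"] mult_left_mono[of "12 * \<alpha>" "7 * \<rho>" "int Q"]
    unfolding X_def Y_def by (auto simp: algebra_simps)
  have cop: "coprime (int J) (2 * \<alpha>)"
  proof -
    have "odd p" using p by (intro prime_odd_nat) auto
    then have "coprime (int p) (2 * \<alpha>)"
      using p(1) alpha(2) by (simp add: prime_imp_coprime)
    then show ?thesis using J by simp
  qed
  have main: "[8 * moment_term n b t k = g k] (mod int p)" if k: "k \<in> {- int t..int t}" for k
  proof -
    define z where "z = int Q - 4 + b * k"
    define W where "W = z div n"
    have le: "l \<le> W \<longleftrightarrow> l * n \<le> z" for l
      unfolding W_def by (rule int_le_div_iff[OF n0])
    have K: "z mod n = z - W * n" by (simp add: W_def minus_div_mult_eq_mod)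
    have val: "[8 * moment_term n b t k = - (2 * \<alpha> * x) * top_coeff (- 4 - W)] (mod int p)"
      if x: "k = int J * x" and W: "-3 \<le> W" "W \<le> 2" for x
    proof -
      have "z - W * n = (int Q - 4 - W) + int Q * (2 * \<alpha> * x - W * \<rho>)"
        unfolding z_def b_def n_def x Q_def by (simp add: algebra_simps)
      then have "[8 * moment_term n b t k = (4 * k\<^sup>2 - 1) * (2 * \<alpha> * x - W * \<rho>) * top_coeff ((int Q - 4 - W) - int Q)] (mod int p)"
        using JQ J7 W K unfolding z_def by (intro moment_term_minus_3[OF p Qp k n0]) auto
      also have "[(4 * k\<^sup>2 - 1) * (2 * \<alpha> * x - W * \<rho>) * top_coeff ((int Q - 4 - W) - int Q)
          = (- 1) * (2 * \<alpha> * x) * top_coeff (- 4 - W)] (mod int p)"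
        using pJ rho by (intro cong_mult) (auto simp: cong_iff_dvd_diff x power2_eq_square)
      finally show ?thesis by simp
    qed
    have zx: "z = int Q - 4 + 2 * Y * x" if "k = int J * x" for x
      unfolding z_def b_def Y_def that Q_def by (simp add: mult_ac)
    have nX: "n = X + 1" by (simp add: n_def X_def)
    consider "k = 0" | "k = int J" | "k = - int J" | "k = 2 * int J" | "k = - 2 * int J"
      | "k \<notin> {0, int J, - int J, 2 * int J, - 2 * int J}" by blast
    then show ?thesis
    proof cases
      case 1
      then have "W = 0" using le[of 0] le[of 1] zx[of 0] nX XQ JQ J7 by auto
      then show ?thesis using val[of 0] 1 J7 by (simp add: g_def)
    next
      case 2
      then have "W = 1" using le[of 1] le[of 2] zx[of 1] nX XQ XY JQ J7 by auto
      then show ?thesis using val[of 1] 2 by (simp add: g_def top_coeff_def)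
    next
      case 3
      then have "W = -2" using le[of "-1"] le[of "-2"] zx[of "-1"] nX XQ XY JQ J7 by auto
      then show ?thesis using val[of "-1"] 3 by (simp add: g_def top_coeff_def)
    next
      case 4
      then have "W = 2" using le[of 2] le[of 3] zx[of 2] nX XQ XY JQ J7 by auto
      then show ?thesis using val[of 2] 4 J7 by (simp add: g_def top_coeff_def)
    next
      case 5
      then have "W = -3" using le[of "-2"] le[of "-3"] zx[of "-2"] nX XQ XY JQ J7 by auto
      then show ?thesis using val[of "-2"] 5 J7 by (simp add: g_def top_coeff_def)
    next
      case 6
      define c where "c = (z mod n) mod int Q"
      define m where "m = (z mod n) div int Q"
      have cm: "z mod n = c + int Q * m" "0 \<le> c" "c < int Q"
        using JQ J7 by (auto simp: c_def m_def)
      have "\<not> (-6 \<le> c - int Q)"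
      proof
        assume c6: "-6 \<le> c - int Q"
        define \<delta> where "\<delta> = c - int Q + 4"
        have delta: "-2 \<le> \<delta>" "\<delta> \<le> 3" using c6 cm by (auto simp: \<delta>_def)
        have eq: "2 * int P * \<alpha> * k - W - \<delta> = int Q * (m + W * \<rho>)"
          using cm(1) K unfolding z_def b_def n_def \<delta>_def by (simp add: algebra_simps)
        have "int P dvd 2 * int P * \<alpha> * k - (2 * int P * \<alpha> * k - W - \<delta>)"
          unfolding eq by (intro dvd_diff) (auto simp: Q_def)
        then have PW: "int P dvd W + \<delta>" by simp
        have PX: "16 * X \<le> int P * X" using P16 XQ JQ J7 by (intro mult_right_mono) auto
        have bk: "12 * \<bar>b * k\<bar> \<le> 7 * (int P * X)"
        proof -
          have "2 * \<bar>k\<bar> \<le> int Q" using k Qp(3) by auto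
          then have "(12 * \<alpha>) * (2 * \<bar>k\<bar>) \<le> (7 * \<rho>) * int Q" using alpha rho7 by (intro mult_mono[of "12 * \<alpha>" "7 * \<rho>"]) auto
          then have "int P * ((12 * \<alpha>) * (2 * \<bar>k\<bar>)) \<le> int P * ((7 * \<rho>) * int Q)" by (intro mult_left_mono) auto
          then show ?thesis using alpha by (simp add: b_def X_def abs_mult mult_ac)
        qed
        have e1: "(int P - 3) * n = int P * X + int P - 3 * X - 3"
          and e2: "(- int P + 3) * n = - (int P * X) - int P + 3 * X + 3"
          by (simp_all add: nX algebra_simps)
        have "\<not> int P - 3 \<le> W"
          using le[of "int P - 3"] e1 bk PX XQ JQ J7 P16 unfolding z_def by linarith
        moreover have "- int P + 3 \<le> W"
          using le[of "- int P + 3"] e2 bk PX XQ JQ J7 P16 unfolding z_def by linarith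
        ultimately have "\<bar>W + \<delta>\<bar> < int P" using delta by linarith
        then have W: "W = - \<delta>" using PW by (meson add_eq_0_iff2 zdvd_not_zless zero_less_abs_iff dvd_abs_iff)
        then have "2 * int P * \<alpha> * k = int Q * (m + W * \<rho>)" using eq by simp
        then have "int P * ((2 * \<alpha>) * k) = int P * (int J * (m + W * \<rho>))"
          unfolding Q_def by (simp add: mult_ac)
        then have "(2 * \<alpha>) * k = int J * (m + W * \<rho>)" using P16 by simp
        then have "int J dvd (2 * \<alpha>) * k" by (metis dvd_triv_left)
        then have "int J dvd k" using cop by (simp add: coprime_dvd_mult_right_iff)
        then obtain x where x: "k = int J * x" by auto
        \<comment> \<open>The top six digits allow only \<open>W\<close> from -3 to 2, while |x| of
          at least 3 wraps beyond that range.\<close>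
        then have "x \<ge> 3 \<or> x \<le> -3" using 6 J7 by (cases "x \<in> {-2,-1,0,1,2}") auto
        then show False
        proof
          assume "x \<ge> 3"
          then have "2 * Y * 3 \<le> 2 * Y * x" using XY XQ JQ J7 by (intro mult_left_mono) auto
          then have "3 \<le> W" using le[of 3] zx[OF x] nX XY XQ JQ J7 by linarith
          then show False using W delta by simp
        next
          assume "x \<le> -3"
          then have "2 * Y * x \<le> 2 * Y * (-3)" using XY XQ JQ J7 by (intro mult_left_mono) auto
          then have "\<not> - 3 \<le> W" using le[of "-3"] zx[OF x] nX XY XQ JQ J7 by linarith
          then show False using W delta by simp
        qed
      qed
      then have "top_coeff (c - int Q) = 0" by (simp add: top_coeff_def)
      then show ?thesis
        using moment_term_minus_3[OF p Qp k n0, of b c m] cm 6 unfolding z_def g_def by auto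
    qed
  qed
  have "[8 * moment n b t = (\<Sum>k = - int t..int t. g k)] (mod int p)"
    unfolding moment_def sum_distrib_left by (intro cong_sum main)
  also have "(\<Sum>k = - int t..int t. g k) = (\<Sum>k\<in>{int J, - int J, 2 * int J, - 2 * int J}. g k)"
    using JQ J7 Qp(3) by (intro sum.mono_neutral_right) (auto simp: g_def)
  also have "\<dots> = 12 * \<alpha>"
    using J7 by (simp add: g_def)
  finally have "int p dvd 12 * \<alpha>"
    using dvd by (metis cong_dvd_iff dvd_mult)
  moreover have "\<not> int p dvd 12"
  proof
    assume "int p dvd 12"
    then have "p dvd 12" by (metis int_dvd_int_iff of_nat_numeral)
    moreover have "(12 :: nat) = 2 * (2 * 3)" by simp
    ultimately have "p dvd 2 * (2 * 3)" by (simp only:)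
    then have "p dvd 2 \<or> p dvd 3" unfolding prime_dvd_mult_iff[OF p(1)] by blast
    then show False using p(2) by (auto dest!: dvd_imp_le)
  qed
  ultimately show False using p(1) alpha(2) by (simp add: prime_dvd_mult_iff)
qed


text \<open>The \<open>p\<close>-part of a - 1 or of a is split off, and \<open>t\<close> is chosen
  so that \<open>2 * t + 3\<close> or \<open>2 * t + 1\<close> is a power of \<open>p\<close> for
  which the moment was shown to be non-zero. These \<open>t\<close> are in the range of
  \<open>vanish\<close> because the complementary power of \<open>p\<close> is at least 7.\<close>

lemma moments_vanish_imp_eq_1:
  fixes p N a :: nat
  assumes p: "prime p" "p > 5" and a: "1 \<le> a" "2 * a < p ^ N + 1" "p dvd a \<or> p dvd a - 1"
    and vanish: "\<And>t. 1 \<le> t \<Longrightarrow> 4 * t + 2 \<le> p ^ N \<Longrightarrow> int p dvd moment (int (p ^ N) + 1) (2 * int a) t"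
  shows "a = 1"
proof (rule ccontr)
  assume "a \<noteq> 1"
  have p7: "p \<ge> 7" using prime_power_ge_7[OF p, of 1] by simp
  have oddp: "odd p" using p by (intro prime_odd_nat) auto
  have nu: "\<not> is_unit p" using p(2) by simp
  show False
  proof (cases "p dvd a")
    case False
    then have "p dvd a - 1" "a - 1 \<noteq> 0" using a \<open>a \<noteq> 1\<close> by auto
    define w where "w = multiplicity p (a - 1)"
    obtain \<beta> where b: "a - 1 = p ^ w * \<beta>" "\<not> p dvd \<beta>"
      using multiplicity_decompose'[OF \<open>a - 1 \<noteq> 0\<close> nu] unfolding w_def by blast
    have b0: "\<beta> > 0" using b \<open>a - 1 \<noteq> 0\<close> by (cases \<beta>) auto
    have w0: "w > 0" using \<open>p dvd a - 1\<close> b by (cases w) auto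
    have lt: "p ^ w * (2 * \<beta>) < p ^ N" using a b by linarith
    then have "p ^ w < p ^ N" using b0 by (metis le_less_trans mult_le_mono2 mult.right_neutral Suc_leI One_nat_def mult_is_0 not_gr_zero zero_neq_numeral)
    then have wN: "w < N" using p7 by (simp add: power_strict_increasing_iff)
    define \<rho> where "\<rho> = p ^ (N - w)"
    have r: "p ^ N = p ^ w * \<rho>" using wN by (simp add: \<rho>_def flip: power_add)
    have rho: "p dvd \<rho>" "odd \<rho>" "2 * \<beta> < \<rho>"
      using wN oddp lt unfolding r by (auto simp: \<rho>_def)
    define t where "t = (p ^ w - 3) div 2"
    have P7: "p ^ w \<ge> 7" using prime_power_ge_7[OF p w0] .
    have "odd (p ^ w)" using oddp by simp
    then have t: "p ^ w = 2 * t + 3" using P7 unfolding t_def by presburger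
    have "p \<le> \<rho>" using rho by (intro dvd_imp_le) auto
    then have "p ^ w * 7 \<le> p ^ N" unfolding r using p7 by (intro mult_le_mono2) auto
    then have "int p dvd moment (int (p ^ N) + 1) (2 * int a) t"
      using t P7 by (intro vanish) linarith+
    moreover have "int a = 1 + int (p ^ w) * int \<beta>"
      using b(1) a(1) by (metis add.commute le_add_diff_inverse2 of_nat_1 of_nat_add of_nat_mult)
    ultimately show False
      using moment_one_mod_prime_power[OF p refl w0 t, of "int \<rho>" "int \<beta>"] rho b b0
      by (simp add: r)
  next
    case True
    define w where "w = multiplicity p a"
    obtain \<alpha> where b: "a = p ^ w * \<alpha>" "\<not> p dvd \<alpha>"
      using multiplicity_decompose'[OF _ nu, of a] a unfolding w_def by (metis not_one_le_zero)
    have b0: "\<alpha> > 0" using b a by (cases \<alpha>) auto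
    have w0: "w > 0" using True b by (cases w) auto
    have "2 * a \<noteq> p ^ N" using oddp by (metis dvd_triv_left even_power)
    then have lt: "p ^ w * (2 * \<alpha>) < p ^ N" using a b by linarith
    then have "p ^ w < p ^ N" using b0 by (metis le_less_trans mult_le_mono2 mult.right_neutral Suc_leI One_nat_def mult_is_0 not_gr_zero zero_neq_numeral)
    then have wN: "w < N" using p7 by (simp add: power_strict_increasing_iff)
    have "p ^ N = p ^ w * p ^ (N - w)" using wN by (simp flip: power_add)
    then have ex: "2 * \<alpha> < p ^ (N - w)" using lt by simp
    \<comment> \<open>The two choices of \<open>Q\<close> below are consecutive: \<open>Q p\<^sup>e = r\<close>, or \<open>Q p\<^bsup>e - 1\<^esup> = r\<close> in case the number of
       surviving terms for the former is \<open>-1\<close> modulo \<open>p\<close>.\<close>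
    define e where "e = (LEAST e. 2 * \<alpha> < p ^ e)"
    have e1: "2 * \<alpha> < p ^ e" unfolding e_def by (rule LeastI[of "\<lambda>e. 2 * \<alpha> < p ^ e", OF ex])
    have e2: "e \<le> N - w" unfolding e_def by (rule Least_le[of "\<lambda>e. 2 * \<alpha> < p ^ e", OF ex])
    have e0: "e > 0" using e1 b0 by (cases e) auto
    have "\<not> 2 * \<alpha> < p ^ (e - 1)" using not_less_Least[of "e - 1" "\<lambda>e. 2 * \<alpha> < p ^ e"] e0 unfolding e_def by simp
    moreover have "2 * \<alpha> \<noteq> p ^ (e - 1)" using oddp by (metis dvd_triv_left even_power)
    ultimately have e3: "p ^ (e - 1) < 2 * \<alpha>" by simp
    define j where "j = N - w - e"
    show False
    proof (cases "p ^ w = p \<or> int (p ^ e) < 2 * int \<alpha> * (int p - 1)")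
      case low: True
      define t where "t = (p ^ w * p ^ j - 1) div 2"
      have "odd (p ^ w * p ^ j)" using oddp by simp
      then have t: "p ^ w * p ^ j = 2 * t + 1" unfolding t_def by presburger
      have r: "p ^ N = p ^ w * p ^ j * p ^ e" unfolding j_def using e2 wN by (simp flip: power_add)
      have P7: "7 \<le> p ^ w * p ^ j" using prime_power_ge_7[OF p, of "w + j"] w0 by (simp add: power_add)
      have "7 \<le> p ^ e" using prime_power_ge_7[OF p e0] .
      then have "p ^ w * p ^ j * 7 \<le> p ^ N" unfolding r by (intro mult_le_mono2)
      then have "int p dvd moment (int (p ^ N) + 1) (2 * int a) t"
        using t P7 by (intro vanish) linarith+
      moreover have "2 * int \<alpha> < int (p ^ e)" using e1 by (metis of_nat_less_iff of_nat_mult of_nat_numeral)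
      moreover have "int p dvd int (p ^ e)" "odd (int (p ^ e))" using e0 oddp by simp_all
      moreover have "int (p ^ N) + 1 = int (p ^ w * p ^ j) * int (p ^ e) + 1" unfolding r by simp
      moreover have "2 * int a = 2 * int (p ^ w) * int \<alpha>" using b(1) by simp
      moreover have "int \<alpha> > 0" "\<not> int p dvd int \<alpha>" using b b0 by simp_all
      ultimately show False
        using moment_zero_mod_prime_power_low[OF p refl w0 refl t, of "int (p ^ e)" "int \<alpha>"] low by metis
    next
      case high: False
      have w1: "w > 1" using high w0 by (cases "w = 1") auto
      have eS: "p ^ e = p * p ^ (e - 1)" using e0 by (simp flip: power_Suc)
      have h: "2 * int \<alpha> * (int p - 1) \<le> int p * int (p ^ (e - 1))" using high eS by simp
      have e1': "e - 1 > 0"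
      proof (rule ccontr)
        assume "\<not> e - 1 > 0"
        then have "2 * int \<alpha> * (int p - 1) \<le> int p" using h by simp
        moreover have "2 * (int p - 1) \<le> 2 * int \<alpha> * (int p - 1)" using b0 p7 by (intro mult_right_mono) auto
        ultimately have "2 * (int p - 1) \<le> int p" by (meson order_trans)
        moreover have "7 \<le> int p" using p7 by simp
        ultimately show False by simp
      qed
      \<comment> \<open>The failed bound, divided by \<open>p\<close>: as 6 p \<le> 7 (p - 1) for p
        at least 7, the ratio 2 \<alpha> / p^(e - 1) is at most 7/6.\<close>
      have "12 * int \<alpha> * (int p - 1) \<le> 6 * int p * int (p ^ (e - 1))"
        using mult_left_mono[OF h, of 6] by (simp add: algebra_simps)
      also have "\<dots> \<le> 7 * (int p - 1) * int (p ^ (e - 1))" using p7 by (intro mult_right_mono) auto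
      finally have "(int p - 1) * (12 * int \<alpha>) \<le> (int p - 1) * (7 * int (p ^ (e - 1)))" by (simp only: mult_ac)
      then have "12 * int \<alpha> \<le> 7 * int (p ^ (e - 1))" using p7 by (simp only: mult_le_cancel_left_pos)
      moreover have "12 * int \<alpha> \<noteq> 7 * int (p ^ (e - 1))"
      proof
        assume "12 * int \<alpha> = 7 * int (p ^ (e - 1))"
        then have "even (7 * int (p ^ (e - 1)))" by (metis dvd_mult2 even_numeral)
        then show False using oddp by simp
      qed
      ultimately have a12: "12 * int \<alpha> < 7 * int (p ^ (e - 1))" by simp
      define t where "t = (p ^ w * p ^ (j + 1) - 3) div 2"
      have P7: "7 \<le> p ^ w * p ^ (j + 1)" using prime_power_ge_7[OF p, of "w + (j + 1)"] w0 by (simp add: power_add mult_ac)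
      have "odd (p ^ w * p ^ (j + 1))" using oddp by simp
      then have t: "p ^ w * p ^ (j + 1) = 2 * t + 3" using P7 unfolding t_def by presburger
      have "N = w + (j + 1) + (e - 1)" unfolding j_def using e0 e2 wN by linarith
      then have r: "p ^ N = p ^ w * p ^ (j + 1) * p ^ (e - 1)" by (metis power_add)
      have "7 \<le> p ^ (e - 1)" using prime_power_ge_7[OF p e1'] .
      then have "p ^ w * p ^ (j + 1) * 7 \<le> p ^ N" unfolding r by (intro mult_le_mono2)
      then have "int p dvd moment (int (p ^ N) + 1) (2 * int a) t"
        using t P7 by (intro vanish) linarith+
      moreover have "int (p ^ (e - 1)) < 2 * int \<alpha>" using e3 by (metis of_nat_less_iff of_nat_mult of_nat_numeral)
      moreover have "int p dvd int (p ^ (e - 1))" using e1' by simp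
      moreover have "int (p ^ N) + 1 = int (p ^ w * p ^ (j + 1)) * int (p ^ (e - 1)) + 1" unfolding r by simp
      moreover have "2 * int a = 2 * int (p ^ w) * int \<alpha>" using b(1) by simp
      moreover have "int \<alpha> > 0" "\<not> int p dvd int \<alpha>" "j + 1 > 0" using b b0 by simp_all
      ultimately show False
        using moment_zero_mod_prime_power_high[OF p refl w1 refl _ t, of "int (p ^ (e - 1))" "int \<alpha>"] a12 by metis
    qed
  qed
qed

subsection \<open>Power sums over subfields and roots of unity\<close>

text \<open>The subfield of order \<open>r\<close>, when \<open>r\<close> is a power of
  \<open>p\<close> and \<open>r - 1\<close> divides \<open>p ^ n - 1\<close>. As sets of fixed
  points, all fields of the tower live inside one type.\<close>

definition frob_fixed :: "nat \<Rightarrow> 'a::field set" where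
  "frob_fixed r = {x. x ^ r = x}"

lemma card_power_eq_le:
  fixes c :: "'a::field"
  assumes "0 < m"
  shows "card {x. x ^ m = c} \<le> m"
proof -
  define f where "f = monom 1 m - [:c:]"
  have "coeff f m = 1" using assms by (simp add: f_def coeff_pCons split: nat.splits)
  then have "f \<noteq> 0" by auto
  then have "card {x. poly f x = 0} \<le> degree f" by (rule card_poly_roots_bound)
  also have "degree f \<le> m"
    unfolding f_def by (intro degree_diff_le) (auto simp: degree_monom_le)
  also have "{x. poly f x = 0} = {x. x ^ m = c}" by (auto simp: f_def poly_monom)
  finally show ?thesis .
qed

locale prime_power_field =
  fixes p n :: nat and ty :: "'a :: {field, finite} itself"
  assumes prime_p: "prime p" and card_UNIV: "CARD('a) = p ^ n"
begin

lemma of_nat_p: "of_nat p = (0 :: 'a)"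
proof -
  have "(\<Sum>x\<in>UNIV. x) = (\<Sum>x\<in>UNIV. x + 1 :: 'a)"
    by (rule sum.reindex_bij_witness[of _ "\<lambda>x. x + 1" "\<lambda>x. x - 1"]) auto
  then have "of_nat (CARD('a)) = (0 :: 'a)" by (simp add: sum.distrib)
  then show ?thesis by (simp add: card_UNIV)
qed

lemma CHAR_eq: "CHAR('a) = p"
proof -
  have "CHAR('a) dvd p" using of_nat_p by (simp add: of_nat_eq_0_iff_char_dvd)
  moreover have "CHAR('a) \<noteq> 1" using of_nat_CHAR[where 'a = 'a] by (metis of_nat_1 zero_neq_one)
  ultimately show ?thesis using prime_p by (auto simp: prime_nat_iff)
qed

lemma of_nat_eq_0: "of_nat m = (0 :: 'a) \<longleftrightarrow> p dvd m"
  using CHAR_eq by (simp add: of_nat_eq_0_iff_char_dvd)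

lemma of_int_eq_0: "of_int z = (0 :: 'a) \<longleftrightarrow> int p dvd z"
proof -
  have "of_int z = (0 :: 'a) \<longleftrightarrow> of_int \<bar>z\<bar> = (0 :: 'a)" by (simp add: abs_if)
  also have "\<dots> \<longleftrightarrow> of_nat (nat \<bar>z\<bar>) = (0 :: 'a)" by (metis abs_ge_zero int_nat_eq of_int_of_nat_eq)
  also have "\<dots> \<longleftrightarrow> int p dvd z" unfolding of_nat_eq_0 by (metis abs_ge_zero dvd_abs_iff int_dvd_int_iff int_nat_eq)
  finally show ?thesis .
qed

lemma frob_add: "(x + y :: 'a) ^ (p ^ j) = x ^ (p ^ j) + y ^ (p ^ j)"
  using CHAR_eq prime_p by (intro freshmans_dream') auto

lemma frob_diff: "(x - y :: 'a) ^ (p ^ j) = x ^ (p ^ j) - y ^ (p ^ j)"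
  using frob_add[of "x - y" y j] by (simp add: algebra_simps)

lemma power_card_minus_1:
  assumes "x \<noteq> (0 :: 'a)"
  shows "x ^ (p ^ n - 1) = 1"
proof -
  have "(\<Prod>y\<in>UNIV-{0}. x * y) = (\<Prod>y\<in>UNIV-{0}. y)"
    by (rule prod.reindex_bij_witness[of _ "\<lambda>y. y / x" "\<lambda>y. x * y"]) (use assms in auto)
  then have "x ^ card (UNIV - {0 :: 'a}) * (\<Prod>y\<in>UNIV-{0}. y) = (\<Prod>y\<in>UNIV-{0::'a}. y)"
    by (simp add: prod.distrib)
  then show ?thesis by (simp add: card_Diff_singleton card_UNIV)
qed

text \<open>Counting replaces cyclicity of the unit group: with m m' = p^n - 1, raising to the power
  m' sends the non-zero elements to m-th roots of unity with fibres of size at most m', so there are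
  at least m such roots.\<close>

lemma card_roots_of_unity:
  assumes "m dvd p ^ n - 1" "0 < m"
  shows "card {x :: 'a. x ^ m = 1} = m"
proof (rule antisym)
  show "card {x :: 'a. x ^ m = 1} \<le> m" by (rule card_power_eq_le[OF assms(2)])
  obtain m' where m': "p ^ n - 1 = m * m'" using assms by auto
  have "CARD('a) \<ge> card {0, 1 :: 'a}" by (intro card_mono) auto
  then have "p ^ n - 1 > 0" by (simp add: card_UNIV)
  then have m'0: "m' > 0" using m' by (cases m') auto
  have "UNIV - {0 :: 'a} \<subseteq> (\<Union>c\<in>{x. x ^ m = 1}. {x. x ^ m' = c})"
  proof
    fix x assume "x \<in> UNIV - {0 :: 'a}"
    then have "x ^ (m' * m) = 1" using power_card_minus_1[of x] unfolding m' by (simp add: mult.commute)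
    then show "x \<in> (\<Union>c\<in>{x. x ^ m = 1}. {x. x ^ m' = c})" by (simp add: power_mult)
  qed
  then have "card (UNIV - {0 :: 'a}) \<le> card (\<Union>c\<in>{x :: 'a. x ^ m = 1}. {x. x ^ m' = c})"
    by (intro card_mono) auto
  also have "\<dots> \<le> (\<Sum>c\<in>{x :: 'a. x ^ m = 1}. card {x. x ^ m' = c})" by (rule card_UN_le) auto
  also have "\<dots> \<le> (\<Sum>c\<in>{x :: 'a. x ^ m = 1}. m')" by (intro sum_mono card_power_eq_le m'0)
  finally have "m * m' \<le> card {x :: 'a. x ^ m = 1} * m'"
    unfolding m'[symmetric] by (simp add: card_Diff_singleton card_UNIV)
  then show "m \<le> card {x :: 'a. x ^ m = 1}" using m'0 by simp
qed

text \<open>Otherwise all m-th roots of unity would be roots of X^(e mod m) - 1, whose degree is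
  positive and less than m.\<close>

lemma root_of_unity_power_neq_1:
  assumes "m dvd p ^ n - 1" "0 < m" and nd: "\<not> m dvd e"
  shows "\<exists>g :: 'a. g ^ m = 1 \<and> g ^ e \<noteq> 1"
proof (rule ccontr)
  assume *: "\<nexists>g :: 'a. g ^ m = 1 \<and> g ^ e \<noteq> 1"
  have "{x :: 'a. x ^ m = 1} \<subseteq> {x. x ^ (e mod m) = 1}"
  proof
    fix x :: 'a assume "x \<in> {x. x ^ m = 1}"
    then have "x ^ m = 1" "x ^ e = 1" using * by auto
    moreover have "x ^ e = (x ^ m) ^ (e div m) * x ^ (e mod m)"
      by (simp flip: power_mult power_add)
    ultimately show "x \<in> {x. x ^ (e mod m) = 1}" by simp
  qed
  then have "card {x :: 'a. x ^ m = 1} \<le> card {x :: 'a. x ^ (e mod m) = 1}" by (intro card_mono) auto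
  also have "\<dots> \<le> e mod m" using nd by (intro card_power_eq_le) (simp add: mod_greater_zero_iff_not_dvd)
  also have "\<dots> < m" using assms by simp
  finally show False using card_roots_of_unity[OF assms(1,2)] by simp
qed

lemma sum_roots_of_unity:
  assumes "m dvd p ^ n - 1" "0 < m"
  shows "(\<Sum>x | x ^ m = (1 :: 'a). x ^ e) = (if m dvd e then of_nat m else 0)"
proof (cases "m dvd e")
  case True
  then have "x ^ e = 1" if "x ^ m = 1" for x :: 'a using that by (auto simp: dvd_def power_mult)
  then have "(\<Sum>x | x ^ m = (1 :: 'a). x ^ e) = (\<Sum>x | x ^ m = (1 :: 'a). 1)" by (intro sum.cong) auto
  then show ?thesis using True card_roots_of_unity[OF assms] by simp
next
  case False
  then obtain g :: 'a where g: "g ^ m = 1" "g ^ e \<noteq> 1" using root_of_unity_power_neq_1[OF assms] by blast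
  then have g0: "g \<noteq> 0" using assms(2) by (auto simp: zero_power)
  have "(\<Sum>x | x ^ m = (1 :: 'a). x ^ e) = (\<Sum>x | x ^ m = (1 :: 'a). (g * x) ^ e)"
    by (rule sum.reindex_bij_witness[of _ "\<lambda>x. g * x" "\<lambda>x. x / g"])
       (use g g0 in \<open>auto simp: power_mult_distrib power_divide\<close>)
  also have "\<dots> = g ^ e * (\<Sum>x | x ^ m = (1 :: 'a). x ^ e)"
    by (simp add: power_mult_distrib sum_distrib_left)
  finally have "(1 - g ^ e) * (\<Sum>x | x ^ m = (1 :: 'a). x ^ e) = 0"
    by (simp add: left_diff_distrib)
  then show ?thesis using g False by simp
qed

lemma frob_fixed_eq:
  assumes "r > 1"
  shows "frob_fixed r = insert 0 {x :: 'a. x ^ (r - 1) = 1}"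
proof -
  have "x ^ r = x * x ^ (r - 1)" for x :: 'a using assms by (simp flip: power_Suc)
  then show ?thesis using assms by (auto simp: frob_fixed_def)
qed

lemma card_frob_fixed:
  assumes "r > 1" "r - 1 dvd p ^ n - 1"
  shows "card (frob_fixed r :: 'a set) = r"
proof -
  have "(0 :: 'a) \<notin> {x. x ^ (r - 1) = 1}" using assms by (simp add: zero_power)
  then show ?thesis using frob_fixed_eq[OF assms(1)] card_roots_of_unity[OF assms(2)] assms(1) by simp
qed

lemma sum_frob_fixed:
  assumes "r > 1" "r - 1 dvd p ^ n - 1" "e > 0"
  shows "(\<Sum>x\<in>frob_fixed r. x ^ e :: 'a) = (if r - 1 dvd e then of_nat (r - 1) else 0)"
proof -
  have "(0 :: 'a) \<notin> {x. x ^ (r - 1) = 1}" using assms by (simp add: zero_power)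
  then show ?thesis using frob_fixed_eq[OF assms(1)] sum_roots_of_unity[OF assms(2), of e] assms by (simp add: zero_power)
qed

lemma frob_fixed_closed:
  assumes "r = p ^ j"
  shows "(0 :: 'a) \<in> frob_fixed r" "(1 :: 'a) \<in> frob_fixed r"
    "(x :: 'a) \<in> frob_fixed r \<Longrightarrow> y \<in> frob_fixed r \<Longrightarrow> x + y \<in> frob_fixed r"
    "(x :: 'a) \<in> frob_fixed r \<Longrightarrow> y \<in> frob_fixed r \<Longrightarrow> x - y \<in> frob_fixed r"
    "(x :: 'a) \<in> frob_fixed r \<Longrightarrow> y \<in> frob_fixed r \<Longrightarrow> x * y \<in> frob_fixed r"
    "(x :: 'a) \<in> frob_fixed r \<Longrightarrow> y \<in> frob_fixed r \<Longrightarrow> x / y \<in> frob_fixed r"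
    "(x :: 'a) \<in> frob_fixed r \<Longrightarrow> x ^ k \<in> frob_fixed r"
proof -
  have "r > 0" using assms prime_gt_0_nat[OF prime_p] by simp
  then show "(0 :: 'a) \<in> frob_fixed r" "(1 :: 'a) \<in> frob_fixed r" by (simp_all add: frob_fixed_def)
  show "x \<in> frob_fixed r \<Longrightarrow> y \<in> frob_fixed r \<Longrightarrow> x + y \<in> frob_fixed r"
    "x \<in> frob_fixed r \<Longrightarrow> y \<in> frob_fixed r \<Longrightarrow> x - y \<in> frob_fixed r"
    "x \<in> frob_fixed r \<Longrightarrow> y \<in> frob_fixed r \<Longrightarrow> x * y \<in> frob_fixed r"
    "x \<in> frob_fixed r \<Longrightarrow> y \<in> frob_fixed r \<Longrightarrow> x / y \<in> frob_fixed r"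
    by (simp_all add: frob_fixed_def assms frob_add frob_diff power_mult_distrib power_divide)
  have "(x ^ k) ^ r = (x ^ r) ^ k" by (simp add: mult.commute flip: power_mult)
  then show "x \<in> frob_fixed r \<Longrightarrow> x ^ k \<in> frob_fixed r" by (simp add: frob_fixed_def)
qed

end

context prime_power_field
begin

lemma power_frob_fixed_cong:
  assumes "x \<in> (frob_fixed r :: 'a set)" "[d = e] (mod r - 1)" "d > 0" "e > 0" "r > 1"
  shows "x ^ d = x ^ e"
proof (cases "x = 0")
  case False
  then have x: "x ^ (r - 1) = 1" using assms(1,5) frob_fixed_eq by auto
  have red: "x ^ m = x ^ (m mod (r - 1))" for m
  proof -
    have "x ^ m = (x ^ (r - 1)) ^ (m div (r - 1)) * x ^ (m mod (r - 1))"
      by (simp flip: power_mult power_add)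
    then show ?thesis using x by simp
  qed
  show ?thesis using red[of d] red[of e] assms(2) by (simp add: cong_def)
qed (use assms in \<open>simp add: zero_power\<close>)

subsection \<open>The prime field\<close>

text \<open>Substituting x = \<delta> y pulls out \<delta>^d and reduces the step \<delta> to the
  step 1; the linear part only adds the constant b \<delta>. So the difference map permutes the
  subfield, whose power sums of exponent strictly between 0 and r - 1 vanish.\<close>

lemma sum_difference_power:
  fixes b \<delta> :: 'a
  assumes r: "r = p ^ j" "r > 1" "r - 1 dvd p ^ n - 1"
    and inj: "inj_on (\<lambda>x :: 'a. (x + 1) ^ d - x ^ d) (frob_fixed r)"
    and b: "b \<in> frob_fixed r" and d: "\<delta> \<in> frob_fixed r" "\<delta> \<noteq> 0" and s: "0 < s" "s < r - 1"
  shows "(\<Sum>x\<in>frob_fixed r. (((x + \<delta>) ^ d + b * (x + \<delta>)) - (x ^ d + b * x)) ^ s) = 0"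
proof -
  note cl = frob_fixed_closed[OF r(1)]
  define g where "g x = ((x + \<delta>) ^ d + b * (x + \<delta>)) - (x ^ d + b * x)" for x
  have g: "g x = \<delta> ^ d * ((x / \<delta> + 1) ^ d - (x / \<delta>) ^ d) + b * \<delta>" for x
  proof -
    have "x + \<delta> = \<delta> * (x / \<delta> + 1)" "x = \<delta> * (x / \<delta>)" using d by (simp_all add: field_simps)
    then have "(x + \<delta>) ^ d = \<delta> ^ d * (x / \<delta> + 1) ^ d" "x ^ d = \<delta> ^ d * (x / \<delta>) ^ d"
      by (metis power_mult_distrib)+
    then show ?thesis by (simp add: g_def algebra_simps)
  qed
  have "inj_on g (frob_fixed r)"
  proof (rule inj_onI)
    fix x y assume xy: "x \<in> frob_fixed r" "y \<in> frob_fixed r" "g x = g y"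
    then have "(x / \<delta> + 1) ^ d - (x / \<delta>) ^ d = (y / \<delta> + 1) ^ d - (y / \<delta>) ^ d"
      using d by (simp add: g)
    then have "x / \<delta> = y / \<delta>" using inj_onD[OF inj] cl(6) xy d by metis
    then show "x = y" using d by simp
  qed
  moreover have "g ` frob_fixed r \<subseteq> frob_fixed r"
    unfolding g_def using b d by (auto intro!: cl)
  ultimately have im: "g ` frob_fixed r = frob_fixed r"
    by (intro endo_inj_surj) auto
  have "(\<Sum>x\<in>frob_fixed r. g x ^ s) = (\<Sum>y\<in>g ` frob_fixed r. y ^ s)"
    using \<open>inj_on g _\<close> by (simp add: sum.reindex)
  also have "\<dots> = 0"
    unfolding im using sum_frob_fixed[OF r(2,3) s(1)] s by (simp add: nat_dvd_not_less)
  finally show ?thesis by (simp add: g_def)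
qed

lemma power_moments_vanish:
  fixes b :: 'a
  assumes p: "p > 2" "p - 1 dvd p ^ n - 1"
    and inj: "inj_on (\<lambda>x :: 'a. (x + 1) ^ d - x ^ d) (frob_fixed p)"
    and b: "b \<in> frob_fixed p" and j: "2 * j < p - 1"
  shows "(\<Sum>x\<in>frob_fixed p. (x ^ d + b * x) ^ j) = 0"
  using j
proof (induction j rule: less_induct)
  case (less j)
  have r: "p = p ^ 1" "p > 1" "p - 1 dvd p ^ n - 1" using p by auto
  note cl = frob_fixed_closed[OF r(1)]
  define F where "F = (frob_fixed p :: 'a set)"
  define \<phi> where "\<phi> x = x ^ d + b * x" for x
  define M where "M i = (\<Sum>x\<in>F. \<phi> x ^ i)" for i
  have M0: "M i = 0" if "i < j" for i
    using less.IH[OF that] that less.prems by (simp add: M_def F_def \<phi>_def)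
  show ?case
  proof (cases "j = 0")
    case True
    then show ?thesis using card_frob_fixed[OF r(2,3)] of_nat_p by simp
  next
    case False
    \<comment> \<open>Grouping the pairs by their difference \<delta> gives sums that vanish by the
      previous lemma. Expanding binomially instead gives products
      \<open>M i * M (2 * j - i)\<close>, in which only i = j has no factor known to be 0.\<close>
    have "(\<Sum>u\<in>F. \<Sum>v\<in>F. (\<phi> u - \<phi> v) ^ (2 * j)) = (\<Sum>v\<in>F. \<Sum>u\<in>F. (\<phi> u - \<phi> v) ^ (2 * j))"
      by (rule sum.swap)
    also have "\<dots> = (\<Sum>v\<in>F. \<Sum>\<delta>\<in>F. (\<phi> (v + \<delta>) - \<phi> v) ^ (2 * j))"
    proof (rule sum.cong[OF refl])
      fix v assume v: "v \<in> F"
      show "(\<Sum>u\<in>F. (\<phi> u - \<phi> v) ^ (2 * j)) = (\<Sum>\<delta>\<in>F. (\<phi> (v + \<delta>) - \<phi> v) ^ (2 * j))"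
        by (rule sum.reindex_bij_witness[of _ "\<lambda>\<delta>. v + \<delta>" "\<lambda>u. u - v"]) (use v cl in \<open>auto simp: F_def\<close>)
    qed
    also have "\<dots> = (\<Sum>\<delta>\<in>F. \<Sum>v\<in>F. (\<phi> (v + \<delta>) - \<phi> v) ^ (2 * j))"
      by (rule sum.swap)
    also have "\<dots> = 0"
    proof (rule sum.neutral, rule ballI)
      fix \<delta> assume "\<delta> \<in> F"
      show "(\<Sum>v\<in>F. (\<phi> (v + \<delta>) - \<phi> v) ^ (2 * j)) = 0"
      proof (cases "\<delta> = 0")
        case True
        then show ?thesis using False by simp
      next
        case False
        then show ?thesis
          using sum_difference_power[OF r inj b _ False, of "2 * j"] \<open>\<delta> \<in> F\<close> \<open>j \<noteq> 0\<close> less.prems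
          by (simp add: F_def \<phi>_def)
      qed
    qed
    finally have "(\<Sum>u\<in>F. \<Sum>v\<in>F. (\<phi> u - \<phi> v) ^ (2 * j)) = 0" .
    moreover have "(\<Sum>u\<in>F. \<Sum>v\<in>F. (\<phi> u - \<phi> v) ^ (2 * j))
        = (\<Sum>i\<le>2 * j. of_nat ((2 * j) choose i) * (-1) ^ (2 * j - i) * M i * M (2 * j - i))"
    proof -
      have "(\<phi> u - \<phi> v) ^ (2 * j) = (\<Sum>i\<le>2 * j. of_nat ((2 * j) choose i) * (-1) ^ (2 * j - i) * \<phi> u ^ i * \<phi> v ^ (2 * j - i))" for u v
        using binomial_ring[of "\<phi> u" "- \<phi> v" "2 * j"] by (simp add: power_minus[of "\<phi> v"] mult_ac)
      then have "(\<Sum>u\<in>F. \<Sum>v\<in>F. (\<phi> u - \<phi> v) ^ (2 * j))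
          = (\<Sum>u\<in>F. \<Sum>i\<le>2 * j. \<Sum>v\<in>F. of_nat ((2 * j) choose i) * (-1) ^ (2 * j - i) * \<phi> u ^ i * \<phi> v ^ (2 * j - i))"
        by (simp add: sum.swap[of _ F "{..2 * j}"])
      also have "\<dots> = (\<Sum>i\<le>2 * j. \<Sum>u\<in>F. \<Sum>v\<in>F. of_nat ((2 * j) choose i) * (-1) ^ (2 * j - i) * \<phi> u ^ i * \<phi> v ^ (2 * j - i))"
        by (rule sum.swap)
      also have "\<dots> = (\<Sum>i\<le>2 * j. of_nat ((2 * j) choose i) * (-1) ^ (2 * j - i) * M i * M (2 * j - i))"
        by (simp add: M_def sum_distrib_left sum_distrib_right mult_ac)
      finally show ?thesis .
    qed
    moreover have "\<dots> = (\<Sum>i\<in>{j}. of_nat ((2 * j) choose i) * (-1) ^ (2 * j - i) * M i * M (2 * j - i))"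
    proof (rule sum.mono_neutral_right)
      show "\<forall>i\<in>{..2 * j} - {j}. of_nat ((2 * j) choose i) * (-1) ^ (2 * j - i) * M i * M (2 * j - i) = 0"
      proof
        fix i assume "i \<in> {..2 * j} - {j}"
        then have "i < j \<or> 2 * j - i < j" by auto
        then show "of_nat ((2 * j) choose i) * (-1) ^ (2 * j - i) * M i * M (2 * j - i) = 0"
          using M0 by auto
      qed
    qed auto
    ultimately have "of_nat ((2 * j) choose j) * (M j * M j) = 0"
      by (auto simp: mult_2)
    moreover have "\<not> p dvd ((2 * j) choose j)"
    proof
      assume "p dvd ((2 * j) choose j)"
      then have "p dvd fact (2 * j)"
        using binomial_fact_lemma[of j "2 * j"] by (metis dvd_mult le_add2 mult_2)
      then show False using prime_p less.prems by (simp add: prime_dvd_fact_iff)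
    qed
    ultimately have "M j = 0" by (simp add: of_nat_eq_0)
    then show ?thesis by (simp add: M_def F_def \<phi>_def)
  qed
qed

text \<open>As a polynomial in b, the power sum of exponent j = c + i has degree at most j and
  vanishes at all p elements of the prime field, hence identically. Its coefficient at b^c is (j
  choose c) times the power sum of exponent c + d i, which would be -1 if p - 1 divided that
  exponent.\<close>

lemma planar_exponent_gap:
  assumes p: "p > 2" "p - 1 dvd p ^ n - 1"
    and inj: "inj_on (\<lambda>x :: 'a. (x + 1) ^ d - x ^ d) (frob_fixed p)" and d: "d > 0"
    and ci: "0 < c + i" "2 * (c + i) < p - 1"
  shows "\<not> p - 1 dvd c + d * i"
proof -
  define F where "F = (frob_fixed p :: 'a set)"
  define j where "j = c + i"
  define S where "S e = (\<Sum>x\<in>F. x ^ e)" for e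
  have cF: "card F = p" unfolding F_def using p by (intro card_frob_fixed) auto
  define P where "P = (\<Sum>k\<le>j. monom (of_nat (j choose k) * S (k + d * (j - k))) k)"
  have "poly P b = poly 0 b" if "b \<in> F" for b
  proof -
    have "(x ^ d + b * x) ^ j = (\<Sum>k\<le>j. of_nat (j choose k) * b ^ k * x ^ (k + d * (j - k)))" for x
      using binomial_ring[of "b * x" "x ^ d" j]
      by (simp add: add.commute power_mult_distrib power_add power_mult mult_ac)
    then have "(\<Sum>x\<in>F. (x ^ d + b * x) ^ j) = (\<Sum>k\<le>j. \<Sum>x\<in>F. of_nat (j choose k) * b ^ k * x ^ (k + d * (j - k)))"
      by (simp add: sum.swap[of _ F])
    also have "\<dots> = poly P b"
      by (simp add: P_def poly_sum poly_monom S_def sum_distrib_left sum_distrib_right mult_ac)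
    finally show ?thesis
      using power_moments_vanish[OF p inj, of b j] that ci by (simp add: F_def j_def)
  qed
  moreover have "degree P \<le> j"
    unfolding P_def by (intro degree_sum_le) (auto intro: order_trans[OF degree_monom_le])
  ultimately have "P = 0"
    using cF ci by (intro poly_eqI_degree[of F]) (auto simp: j_def)
  then have "coeff P c = 0" by simp
  moreover have "coeff P c = of_nat (j choose c) * S (c + d * (j - c))"
    by (simp add: P_def coeff_sum j_def)
  moreover have "\<not> p dvd (j choose c)"
  proof
    assume "p dvd (j choose c)"
    then have "p dvd fact j" using binomial_fact_lemma[of c j] by (metis dvd_mult j_def le_add1)
    then show False using prime_p ci by (simp add: prime_dvd_fact_iff j_def)
  qed
  ultimately have "S (c + d * i) = 0" by (simp add: of_nat_eq_0 j_def)
  then show ?thesis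
    using sum_frob_fixed[of p "c + d * i"] p ci d by (auto simp: S_def F_def of_nat_p split: if_splits)
qed

text \<open>Here x^d is x times its quadratic character. If m and m + 1 are both non-zero squares,
  the difference at m is 1, the same as at 0.\<close>

lemma power_half_not_planar:
  assumes p: "p > 5" "p - 1 dvd p ^ n - 1"
    and inj: "inj_on (\<lambda>x :: 'a. (x + 1) ^ d - x ^ d) (frob_fixed p)"
    and d: "[d = (p - 1) div 2 + 1] (mod p - 1)" "d > 0"
  shows False
proof -
  note cl = frob_fixed_closed[of p 1, simplified]
  define h where "h = (p - 1) div 2"
  have "odd p" using prime_p p by (intro prime_odd_nat) auto
  then have h: "p - 1 = 2 * h" unfolding h_def by simp
  have nz: "of_nat m \<noteq> (0 :: 'a)" if "0 < m" "m < p" for m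
    using that by (auto simp: of_nat_eq_0 dest!: dvd_imp_le)
  have nz': "of_nat m \<noteq> (0 :: 'a)" if "m \<in> {1, 2, 3, 4, 5}" for m
    using that p by (intro nz) auto
  have memF: "(of_nat m :: 'a) \<in> frob_fixed p" for m
    by (induction m) (simp_all add: cl(1,2,3))
  have val: "(of_nat m :: 'a) ^ d = of_nat m * of_nat m ^ h" for m
  proof -
    have "(of_nat m :: 'a) ^ d = of_nat m ^ (h + 1)"
      using p d memF by (intro power_frob_fixed_cong[of _ p]) (auto simp: h_def)
    then show ?thesis by simp
  qed
  have pm: "(of_nat m :: 'a) ^ h = 1 \<or> (of_nat m :: 'a) ^ h = -1" if "of_nat m \<noteq> (0 :: 'a)" for m
  proof -
    have "(of_nat m :: 'a) ^ (p - 1) = 1"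
      using memF[of m] that frob_fixed_eq[of p] p by auto
    then have "((of_nat m :: 'a) ^ h)\<^sup>2 = 1" unfolding h by (simp add: mult.commute flip: power_mult)
    then show ?thesis by (simp add: power2_eq_1_iff)
  qed
  have sq: "(of_nat (m * m) :: 'a) ^ h = 1" if "of_nat m \<noteq> (0 :: 'a)" for m
  proof -
    have "(of_nat (m * m) :: 'a) ^ h = (of_nat m ^ h) * (of_nat m ^ h)" by (simp add: power_mult_distrib)
    then show ?thesis using pm[OF that] by auto
  qed
  have no: False if "of_nat m \<noteq> (0 :: 'a)" "(of_nat m :: 'a) ^ h = 1" "(of_nat (Suc m) :: 'a) ^ h = 1" for m
  proof -
    have "(of_nat m + 1 :: 'a) ^ d - of_nat m ^ d = (0 + 1) ^ d - 0 ^ d"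
      using val[of "Suc m"] val[of m] that d(2) by (simp add: zero_power add.commute)
    then have "of_nat m = (0 :: 'a)"
      using inj memF[of m] cl(1) unfolding inj_on_def by blast
    then show False using that by simp
  qed
  \<comment> \<open>One of 2, 5, 10 is a square, and it follows the square 1, 4, 9, respectively.\<close>
  have q2: "(of_nat 2 :: 'a) ^ h = -1"
    using no[of 1] pm[of 2] nz'[of 1] nz'[of 2] by (auto simp: numeral_2_eq_2)
  have q5: "(of_nat 5 :: 'a) ^ h = -1"
    using no[of 4] pm[of 5] nz'[of 4] nz'[of 5] nz'[of 2] sq[of 2] by auto
  have "(of_nat (2 * 5) :: 'a) ^ h = of_nat 2 ^ h * of_nat 5 ^ h" by (simp only: of_nat_mult power_mult_distrib)
  then have "(of_nat 10 :: 'a) ^ h = 1" using q2 q5 by simp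
  moreover have "of_nat (3 * 3) \<noteq> (0 :: 'a)" using nz'[of 3] by (simp only: of_nat_mult mult_eq_0_iff) auto
  ultimately show False using no[of 9] sq[of 3] nz'[of 3] by simp
qed

lemma planar_exponent_prime_field:
  assumes p: "p > 5" "p - 1 dvd p ^ n - 1"
    and inj: "inj_on (\<lambda>x :: 'a. (x + 1) ^ d - x ^ d) (frob_fixed p)"
  shows "[d = 2] (mod p - 1)"
proof -
  note cl = frob_fixed_closed[of p 1, simplified]
  have "odd p" using prime_p p by (intro prime_odd_nat) auto
  define h where "h = (p - 1) div 2"
  have h: "p - 1 = 2 * h" using \<open>odd p\<close> unfolding h_def by simp
  have h3: "h \<ge> 3" using h p by linarith
  have two: "\<exists>x y. x \<noteq> y \<and> x \<in> (frob_fixed p :: 'a set) \<and> y \<in> (frob_fixed p :: 'a set)"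
    using cl(1,2) by (intro exI[of _ 0] exI[of _ 1]) auto
  have d0: "d > 0"
  proof (rule ccontr)
    assume "\<not> d > 0"
    then show False using inj two unfolding inj_on_def by (simp, blast)
  qed
  define e where "e = d mod (p - 1)"
  have de: "[d = e] (mod p - 1)" by (simp add: e_def cong_def)
  have e_lt: "e < 2 * h" using h h3 by (simp add: e_def)
  have gap: "\<not> 2 * h dvd c + e * i" if "0 < c + i" "c + i < h" for c i
  proof -
    have "[c + d * i = c + e * i] (mod p - 1)" by (intro cong_add cong_mult cong_refl de)
    moreover have "p > 2" "2 * (c + i) < p - 1" using that h p by auto
    then have "\<not> p - 1 dvd c + d * i" using planar_exponent_gap[OF _ p(2) inj d0 that(1)] by blast
    ultimately show ?thesis using cong_dvd_iff h by metis
  qed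
  have "e \<noteq> 0" using gap[of 0 1] h3 by (intro notI) simp
  moreover have "e \<noteq> 1"
  proof
    assume "e = 1"
    then have "x ^ d = x" if "x \<in> frob_fixed p" for x :: 'a
      using power_frob_fixed_cong[OF that de] d0 p by simp
    then have const: "(x + 1) ^ d - x ^ d = 1" if "x \<in> frob_fixed p" for x :: 'a
      using that cl(3)[OF that cl(2)] by simp
    obtain x y :: 'a where xy: "x \<noteq> y" "x \<in> frob_fixed p" "y \<in> frob_fixed p" using two by blast
    have "(x + 1) ^ d - x ^ d = (y + 1) ^ d - y ^ d" using const xy by simp
    then show False using inj xy unfolding inj_on_def by blast
  qed
  moreover have "\<not> (3 \<le> e \<and> e \<le> h)"
  proof
    assume e: "3 \<le> e \<and> e \<le> h"
    \<comment> \<open>The gap lemma is applied with c + e i equal to p - 1 itself, by division with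
      remainder. It needs c + i < h, equivalently c < (e - 2) i.\<close>
    define i where "i = (2 * h) div e"
    define c where "c = (2 * h) mod e"
    have ic: "2 * h = c + e * i" "c < e" using e by (auto simp: i_def c_def)
    have "2 * e \<le> 2 * h" using e by simp
    then have i2: "i \<ge> 2" unfolding i_def using e by (simp add: less_eq_div_iff_mult_less_eq)
    have "c < (e - 2) * i"
    proof (cases "e = 3")
      case True
      \<comment> \<open>For e = 3 the only bad case is h = 4 with c = i = 2, which would need p =
        9.\<close>
      have "p \<noteq> 9"
      proof
        assume "p = 9"
        then have "3 dvd p" by simp
        then show False using prime_nat_not_dvd[OF prime_p, of 3] p(1) by simp
      qed
      then have "h \<noteq> 4" using h by auto
      moreover have "2 * h = c + 3 * i" "c < 3" using ic True by auto
      ultimately have "c < i" using i2 by linarith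
      then show ?thesis using True by simp
    next
      case False
      then have "2 * e - 4 \<le> (e - 2) * i" using e i2 mult_le_mono2[of 2 i "e - 2"] by linarith
      then show ?thesis using ic e False by linarith
    qed
    moreover have "e * i = (e - 2) * i + 2 * i" using e by (simp add: diff_mult_distrib)
    ultimately have "c + i < h" using ic by linarith
    moreover have "0 < c + i" using i2 by simp
    ultimately show False using gap[of c i] ic by simp
  qed
  moreover have "\<not> h + 2 \<le> e"
  proof
    assume "h + 2 \<le> e"
    then have "2 * h - e + 1 < h" using e_lt by linarith
    then show False using gap[of "2 * h - e" 1] e_lt by simp
  qed
  moreover have "e \<noteq> h + 1"
    using power_half_not_planar[OF p inj _ d0] de unfolding h_def by blast
  ultimately have "e = 2" by linarith
  then show ?thesis using de by simp
qed

end

subsection \<open>The quadratic step\<close>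

locale quadratic_step = prime_power_field p n ty
  for p n :: nat and ty :: "'a :: {field, finite} itself" +
  fixes N r :: nat
  assumes p5: "p > 5" and N: "N > 0" and r: "r = p ^ N" and r2: "r\<^sup>2 - 1 dvd p ^ n - 1"
begin

text \<open>The kernel of the norm from the field of order r^2 to that of order r; on it the
  Frobenius map x^r is inversion.\<close>

definition U :: "'a set" where "U = {v. v ^ (r + 1) = 1}"

lemma r7: "r \<ge> 7" using prime_power_ge_7[OF prime_p p5 N] r by simp

lemma odd_p: "odd p" using prime_p p5 by (intro prime_odd_nat) auto

lemma odd_r: "odd r" using odd_p r by simp

lemma of_nat_r: "of_nat r = (0 :: 'a)" using of_nat_p N r by simp

lemma square_minus_1: "r\<^sup>2 - 1 = (r - 1) * (r + 1)"
  by (simp add: algebra_simps power2_eq_square)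

lemma dvd_card: "r - 1 dvd p ^ n - 1" "r + 1 dvd p ^ n - 1"
  using r2 unfolding square_minus_1 by (rule dvd_mult_left, rule dvd_mult_right)

lemma card_U: "card U = r + 1"
  unfolding U_def by (rule card_roots_of_unity[OF dvd_card(2)]) simp

lemma U_nonzero: "v \<in> U \<Longrightarrow> v \<noteq> 0"
  by (auto simp: U_def)

lemma one_in_U: "1 \<in> U" by (simp add: U_def)

lemma U_power_r: "v \<in> U \<Longrightarrow> v ^ r = inverse v"
  by (simp add: U_def inverse_unique)

lemma U_powi_mod:
  assumes "v \<in> U"
  shows "v powi e = v ^ nat (e mod (int r + 1))"
proof -
  have "v powi e = v powi ((int r + 1) * (e div (int r + 1)) + e mod (int r + 1))" by simp
  also have "\<dots> = (v powi (int r + 1)) powi (e div (int r + 1)) * v powi (e mod (int r + 1))"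
    using U_nonzero[OF assms] by (simp only: power_int_add power_int_mult simp_thms)
  also have "v powi (int r + 1) = v ^ (r + 1)"
    by (metis of_nat_1 of_nat_add power_int_of_nat)
  finally show ?thesis using assms by (simp add: U_def power_int_nonneg_exp)
qed

section \<open>Sums over \<open>U\<close> with a pole at 1\<close>

lemma sum_U_powi: "(\<Sum>v\<in>U. v powi e) = (if int r + 1 dvd e then 1 else 0)"
proof -
  have "(\<Sum>v\<in>U. v powi e) = (\<Sum>v\<in>U. v ^ nat (e mod (int r + 1)))"
    by (intro sum.cong U_powi_mod) auto
  also have "\<dots> = (if r + 1 dvd nat (e mod (int r + 1)) then of_nat (r + 1) else 0)"
    unfolding U_def by (rule sum_roots_of_unity[OF dvd_card(2)]) simp
  also have "r + 1 dvd nat (e mod (int r + 1)) \<longleftrightarrow> int r + 1 dvd e"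
  proof -
    have "r + 1 dvd nat (e mod (int r + 1)) \<longleftrightarrow> int (r + 1) dvd int (nat (e mod (int r + 1)))"
      by (simp only: int_dvd_int_iff)
    also have "int (nat (e mod (int r + 1))) = e mod (int r + 1)" by simp
    also have "int (r + 1) dvd e mod (int r + 1) \<longleftrightarrow> int r + 1 dvd e" by (simp add: dvd_mod_iff add.commute)
    finally show ?thesis .
  qed
  finally show ?thesis using of_nat_r by simp
qed

text \<open>Expanding \<open>h v ^ (2 * t)\<close> binomially and summing over v leaves a
  combination of these sums with x = 4t.\<close>

definition T :: "nat \<Rightarrow> int \<Rightarrow> 'a" where
  "T x e = (\<Sum>v\<in>U - {1}. v powi e / (v - 1) ^ x)"

lemma T_0: "T 0 e = (if int r + 1 dvd e then 1 else 0) - 1"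
proof -
  have "(\<Sum>v\<in>U. v powi e) = 1 + T 0 e"
    unfolding T_def using sum.remove[of U 1 "\<lambda>v. v powi e"] one_in_U by simp
  then show ?thesis unfolding sum_U_powi by (simp only: add_diff_cancel_left')
qed

lemma T_Suc: "T (Suc x) (e + 1) - T (Suc x) e = T x e"
proof -
  have "T (Suc x) (e + 1) - T (Suc x) e
      = (\<Sum>v\<in>U - {1}. v powi (e + 1) / (v - 1) ^ Suc x - v powi e / (v - 1) ^ Suc x)"
    by (simp add: T_def sum_subtractf)
  also have "\<dots> = T x e"
    unfolding T_def
  proof (rule sum.cong[OF refl])
    fix v assume v: "v \<in> U - {1}"
    have "v powi (e + 1) / (v - 1) ^ Suc x - v powi e / (v - 1) ^ Suc x = v powi e * (v - 1) / ((v - 1) * (v - 1) ^ x)"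
    proof -
      have "v powi (e + 1) = v powi e * v" using U_nonzero v by (intro power_int_add_1) auto
      then show ?thesis by (simp add: right_diff_distrib diff_divide_distrib)
    qed
    then show "v powi (e + 1) / (v - 1) ^ Suc x - v powi e / (v - 1) ^ Suc x = v powi e / (v - 1) ^ x"
      using v by simp
  qed
  finally show ?thesis .
qed

text \<open>Each v in \<open>U\<close> other than 1 is a root of 1 + X + ... + X^r. This fixes the
  constant that the difference equation \<open>T_Suc\<close> leaves open.\<close>

lemma sum_T_period: "(\<Sum>e = 0..int r. T x e) = 0"
proof -
  have "(\<Sum>e = 0..int r. T x e) = (\<Sum>v\<in>U - {1}. \<Sum>e = 0..int r. v powi e / (v - 1) ^ x)"
    unfolding T_def by (rule sum.swap)
  also have "\<dots> = 0"
  proof (rule sum.neutral, rule ballI)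
    fix v assume v: "v \<in> U - {1}"
    have "(\<Sum>e = 0..int r. v powi e) = (\<Sum>e = 0..<r + 1. v ^ e)"
      by (rule sum.reindex_bij_witness[of _ int nat]) (auto simp: power_int_nonneg_exp)
    also have "\<dots> = 0"
      using v geometric_sum[of v "r + 1"] by (simp add: U_def atLeast0LessThan)
    finally show "(\<Sum>e = 0..int r. v powi e / (v - 1) ^ x) = 0"
      by (simp flip: sum_divide_distrib)
  qed
  finally show ?thesis .
qed

lemma choose_r_eq_0:
  assumes "0 < x" "x < r"
  shows "of_nat (r choose x) = (0 :: 'a)"
  using prime_dvd_choose_prime_power[OF prime_p assms(1)] assms(2) r by (simp add: of_nat_eq_0)

text \<open>Both sides have the same differences in e, the left one by \<open>T_Suc\<close> and
  induction, the right one by Pascal's rule. At the wrap from r to 0 both differences vanish, since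
  the interior of row r is 0 modulo \<open>p\<close>. The remaining constant is 0 because both sides
  sum to 0 over a period, the right one by the hockey-stick identity.\<close>

lemma T_eq_choose:
  assumes "1 \<le> x" "x + 2 \<le> r"
  shows "T x e = - of_nat (nat ((e - 1) mod (int r + 1)) choose x)"
  using assms
proof (induction x arbitrary: e)
  case (Suc x)
  define K where "K e = nat ((e - 1) mod (int r + 1))" for e
  define D where "D e = T (Suc x) e + of_nat (K e choose Suc x)" for e
  have K_wrap: "K e = r \<and> K (e + 1) = 0" if "int r + 1 dvd e" for e
  proof -
    have "e mod (int r + 1) = 0" using that by simp
    then have "(e - 1) mod (int r + 1) = (0 - 1) mod (int r + 1)" by (simp flip: mod_diff_left_eq[of e])
    also have "\<dots> = int r" by (simp add: zmod_minus1)
    finally show ?thesis using that by (simp add: K_def)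
  qed
  have K_step: "K (e + 1) = Suc (K e)" if "\<not> int r + 1 dvd e" for e
  proof -
    have "(e - 1) mod (int r + 1) + 1 < int r + 1"
    proof (rule ccontr)
      assume "\<not> ?thesis"
      then have "(e - 1) mod (int r + 1) = int r"
        using pos_mod_bound[of "int r + 1" "e - 1"] by linarith
      then have "(e - 1 + 1) mod (int r + 1) = (int r + 1) mod (int r + 1)"
        by (simp only: flip: mod_add_left_eq[of "e - 1"])
      then show False using that by (simp add: dvd_eq_mod_eq_0)
    qed
    moreover have "0 \<le> (e - 1) mod (int r + 1)" by simp
    ultimately have "((e - 1) mod (int r + 1) + 1) mod (int r + 1) = (e - 1) mod (int r + 1) + 1"
      by (intro mod_pos_pos_trivial) auto
    then have "(e - 1 + 1) mod (int r + 1) = (e - 1) mod (int r + 1) + 1"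
      by (simp only: mod_add_left_eq)
    then show ?thesis by (simp add: K_def nat_add_distrib)
  qed
  have step: "D (e + 1) = D e" for e
  proof -
    have "D (e + 1) - D e = T x e + (of_nat (K (e + 1) choose Suc x) - of_nat (K e choose Suc x))"
      using T_Suc[of x e] by (simp add: D_def algebra_simps)
    also have "\<dots> = 0"
    proof (cases "int r + 1 dvd e")
      case True
      \<comment> \<open>For x = 0 the closed form fails exactly at multiples of r + 1, where
        \<open>T_0\<close> gives 0, the value wanted here.\<close>
      have "T x e = 0"
      proof (cases "x = 0")
        case False
        then show ?thesis
          using Suc.IH[of e] Suc.prems K_wrap[OF True] choose_r_eq_0[of x] by (simp add: K_def)
      qed (use T_0 True in simp)
      then show ?thesis using K_wrap[OF True] choose_r_eq_0[of "Suc x"] Suc.prems by simp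
    next
      case False
      have "T x e = - of_nat (K e choose x)"
      proof (cases "x = 0")
        case True
        then show ?thesis using T_0 False by simp
      next
        case False
        then show ?thesis using Suc.IH[of e] Suc.prems by (simp add: K_def)
      qed
      then show ?thesis using K_step[OF False] by simp
    qed
    finally show ?thesis by simp
  qed
  have const: "D e = D 0" for e
  proof (induction e rule: int_induct[where k = 0])
    case (step1 i) then show ?case using step[of i] by simp
  next
    case (step2 i) then show ?case using step[of "i - 1"] by simp
  qed simp
  have "(\<Sum>e = 0..int r. D e) = (\<Sum>e = 0..int r. of_nat (K e choose Suc x))"
    unfolding D_def by (simp add: sum.distrib sum_T_period)
  also have "\<dots> = (\<Sum>k\<le>r. of_nat (k choose Suc x))"
  proof -
    have "(\<Sum>e = 0..int r. of_nat (K e choose Suc x) :: 'a) = (\<Sum>e = 1..int r + 1. of_nat (K e choose Suc x))"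
    proof -
      have "{0..int r} = insert 0 {1..int r}" "{1..int r + 1} = insert (int r + 1) {1..int r}" by auto
      moreover have "K 0 = K (int r + 1)" using K_wrap[of 0] K_wrap[of "int r + 1"] by simp
      ultimately show ?thesis by simp
    qed
    also have "\<dots> = (\<Sum>k\<le>r. of_nat (k choose Suc x))"
      by (rule sum.reindex_bij_witness[of _ "\<lambda>k. int k + 1" "\<lambda>e. nat (e - 1)"]) (auto simp: K_def)
    finally show ?thesis .
  qed
  also have "\<dots> = of_nat ((r choose Suc x) + (r choose Suc (Suc x)))"
    using sum_choose_upper[of "Suc x" r] by (simp flip: of_nat_sum)
  also have "\<dots> = 0" using Suc.prems choose_r_eq_0[of "Suc x"] choose_r_eq_0[of "Suc (Suc x)"] by simp
  also have "(\<Sum>e = 0..int r. D e) = (\<Sum>e = 0..int r. D 0)" by (intro sum.cong refl const)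
  also have "\<dots> = of_nat (r + 1) * D 0" by (simp add: nat_add_distrib)
  finally have "D 0 = 0" using of_nat_r by simp
  then have "D e = 0" using const[of e] by simp
  then show ?case by (simp add: D_def K_def add_eq_0_iff2)
qed simp

end

context prime_power_field
begin

lemma frob_inj: "(x :: 'a) ^ (p ^ j) = y ^ (p ^ j) \<Longrightarrow> x = y"
proof -
  assume "x ^ (p ^ j) = y ^ (p ^ j)"
  then have "(x - y) ^ (p ^ j) = 0" by (simp add: frob_diff)
  then show "x = y" by simp
qed

lemma planar_exponent_frob:
  assumes "inj_on (\<lambda>x :: 'a. (x + 1) ^ d - x ^ d) F"
  shows "inj_on (\<lambda>x :: 'a. (x + 1) ^ (d * p ^ j) - x ^ (d * p ^ j)) F"
proof (rule inj_onI)
  fix x y :: 'a assume xy: "x \<in> F" "y \<in> F"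
    "(x + 1) ^ (d * p ^ j) - x ^ (d * p ^ j) = (y + 1) ^ (d * p ^ j) - y ^ (d * p ^ j)"
  have "((x + 1) ^ d - x ^ d) ^ (p ^ j) = ((y + 1) ^ d - y ^ d) ^ (p ^ j)"
    using xy(3) by (simp add: frob_diff flip: power_mult)
  then have "(x + 1) ^ d - x ^ d = (y + 1) ^ d - y ^ d" by (rule frob_inj)
  then show "x = y" using assms xy unfolding inj_on_def by blast
qed

end

context quadratic_step
begin

definition F2 :: "'a set" where "F2 = frob_fixed (r\<^sup>2)"

lemma r_square: "r\<^sup>2 = p ^ (2 * N)"
  by (simp add: r mult.commute flip: power_mult)

lemmas F2_closed = frob_fixed_closed[OF r_square, folded F2_def]
lemmas Fr_closed = frob_fixed_closed[OF r]

lemma frob_r_diff: "(x - y :: 'a) ^ r = x ^ r - y ^ r"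
  unfolding r by (rule frob_diff)

lemma Fr_subset: "frob_fixed r \<subseteq> F2"
  unfolding F2_def frob_fixed_def by (auto simp: power2_eq_square power_mult)

lemma U_subset: "U \<subseteq> F2"
proof
  fix v assume v: "v \<in> U"
  have "v ^ r\<^sup>2 = (v ^ r) ^ r" by (simp add: power2_eq_square flip: power_mult)
  also have "\<dots> = v" using U_power_r[OF v] by (simp add: power_inverse)
  finally show "v \<in> F2" by (simp add: F2_def frob_fixed_def)
qed

lemma two_nonzero: "(2 :: 'a) \<noteq> 0"
proof -
  have "of_nat 2 \<noteq> (0 :: 'a)" using p5 by (auto simp only: of_nat_eq_0 dest!: dvd_imp_le)
  then show ?thesis by simp
qed

end

section \<open>Power sums attached to a planar exponent\<close>

locale planar_step = quadratic_step p n ty N r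
  for p n :: nat and ty :: "'a :: {field, finite} itself" and N r :: nat +
  fixes d m :: nat
  assumes inj: "inj_on (\<lambda>x :: 'a. (x + 1) ^ d - x ^ d) (frob_fixed (r\<^sup>2))"
    and d: "d = 2 + m * (r - 1)"
begin

definition A :: int where "A = int m - 1"

text \<open>For v in \<open>U\<close> other than 1, a non-zero \<delta> with \<delta>^r = -
  \<delta>, and X = 1 / ((1 - v) \<delta>), one has X^r = v X, and \<open>h v\<close> is \<delta>^2
  (X^d - X^(d r)): it measures how far X^d is from the field of order r.\<close>

definition h :: "'a \<Rightarrow> 'a" where "h v = v * (v powi A - v powi (- A)) / (v - 1)\<^sup>2"

text \<open>On the small field the difference at z is 2 z + 1 and takes every value there. So the
  value c at y is also taken at z = (c - 1)/2, and injectivity gives y = z.\<close>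

lemma in_subfield_if_difference_in_subfield:
  assumes "y \<in> F2" "(y + 1) ^ d - y ^ d \<in> frob_fixed r"
  shows "y \<in> frob_fixed r"
proof -
  define c where "c = (y + 1) ^ d - y ^ d"
  define z where "z = (c - 1) / 2"
  have two: "2 \<in> (frob_fixed r :: 'a set)" using Fr_closed(3)[OF Fr_closed(2) Fr_closed(2)] by simp
  have z: "z \<in> frob_fixed r" unfolding z_def using assms(2) two
    by (intro Fr_closed) (simp_all add: c_def Fr_closed(2))
  have sq: "x ^ d = x\<^sup>2" if "x \<in> frob_fixed r" for x :: 'a
  proof -
    have "[d = 2] (mod r - 1)" unfolding d by (simp only: cong_def mod_mult_self1)
    then show ?thesis using that r7 by (intro power_frob_fixed_cong[of _ r]) (auto simp: d)
  qed
  have "(z + 1) ^ d - z ^ d = 2 * z + 1"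
    using sq[OF z] sq[OF Fr_closed(3)[OF z Fr_closed(2)]] by (simp add: power2_eq_square algebra_simps)
  also have "\<dots> = (y + 1) ^ d - y ^ d"
  proof -
    have "2 * z = c - 1" using two_nonzero unfolding z_def by simp
    then show ?thesis by (simp add: c_def)
  qed
  finally have "z = y" using inj assms(1) z Fr_subset unfolding inj_on_def F2_def by blast
  then show ?thesis using z by simp
qed

lemma h_frob:
  assumes "v \<in> U - {1}"
  shows "(h v) ^ r = - h v"
proof -
  have v: "v \<noteq> 0" "v ^ r = inverse v" "v \<noteq> 1" using assms U_nonzero U_power_r by auto
  have pw: "(v powi e) ^ r = v powi (- e)" for e
  proof -
    have "(v powi e) ^ r = (v ^ r) powi e" by (simp add: power_int_power power_int_power' mult.commute)
    then show ?thesis using v by (simp add: power_int_inverse power_int_minus)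
  qed
  have "(h v) ^ r = v ^ r * ((v powi A) ^ r - (v powi (- A)) ^ r) / ((v ^ r - 1)\<^sup>2)"
  proof -
    have "((v - 1)\<^sup>2) ^ r = (v ^ r - 1)\<^sup>2" using frob_r_diff[of v 1] by (metis power_commuting_commutes power_mult mult.commute power_one)
    then show ?thesis by (simp add: h_def power_mult_distrib power_divide frob_r_diff)
  qed
  also have "\<dots> = inverse v * (v powi (- A) - v powi A) / (inverse v - 1)\<^sup>2"
    using v pw[of A] pw[of "- A"] by simp
  also have "(inverse v - 1)\<^sup>2 = (v - 1)\<^sup>2 * (inverse v)\<^sup>2"
    using v by (simp add: field_simps power2_eq_square)
  also have "inverse v * (v powi (- A) - v powi A) / ((v - 1)\<^sup>2 * (inverse v)\<^sup>2) = - h v"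
  proof -
    have aux: "inverse v * x / (y * (inverse v)\<^sup>2) = v * x / y" for x y
      using v(1) by (cases "y = 0") (simp_all add: field_simps power2_eq_square)
    show ?thesis unfolding aux by (simp add: h_def right_diff_distrib diff_divide_distrib)
  qed
  finally show ?thesis .
qed

text \<open>Equal values of \<open>h\<close> make (X v)^d - (X w)^d a fixed point of x^r. Then
  \<open>X w\<close> lies in the field of order r by the lemma on differences, contradicting (X w)^r
  = w (X w) with w other than 1.\<close>

lemma h_inj: "inj_on h (U - {1})"
proof (rule inj_onI, rule ccontr)
  fix v w assume v: "v \<in> U - {1}" and w: "w \<in> U - {1}" and eq: "h v = h w" and ne: "v \<noteq> w"
  \<comment> \<open>\<open>1 / (1 - v)\<close> and \<open>1 / (1 - w)\<close> have trace 1, so scaling by their difference \<open>\<delta>\<close> yields elements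
     \<open>X v\<close>, \<open>X w\<close> that differ by 1 and satisfy \<open>(X u)\<^bsup>r - 1\<^esup> = u\<close>.\<close>
  define \<delta> where "\<delta> = 1 / (1 - v) - 1 / (1 - w)"
  have U1: "1 / (1 - u) \<in> F2" "(1 / (1 - u)) ^ r = - u * (1 / (1 - u))" if "u \<in> U - {1}" for u
  proof -
    show "1 / (1 - u) \<in> F2" using that U_subset by (intro F2_closed(6)[OF F2_closed(2)] F2_closed(4)[OF F2_closed(2)]) auto
    have "u \<noteq> 0" "u \<noteq> 1" "u ^ r = inverse u" using that U_nonzero U_power_r by auto
    then show "(1 / (1 - u)) ^ r = - u * (1 / (1 - u))"
      by (simp add: power_divide frob_r_diff) (simp add: field_simps)
  qed
  have d0: "\<delta> \<noteq> 0"
  proof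
    assume "\<delta> = 0"
    then have "inverse (1 - v) = inverse (1 - w)" by (simp add: \<delta>_def inverse_eq_divide)
    then show False using ne by simp
  qed
  have sub: "- u * (1 / (1 - u)) = 1 - 1 / (1 - u)" if "u \<in> U - {1}" for u
    using that by (simp add: field_simps)
  have dr: "\<delta> ^ r = - \<delta>"
    unfolding \<delta>_def frob_r_diff U1(2)[OF v] U1(2)[OF w] sub[OF v] sub[OF w] by simp
  have dF: "\<delta> \<in> F2" unfolding \<delta>_def by (intro F2_closed(4) U1 v w)
  define X where "X u = 1 / (1 - u) / \<delta>" for u
  have XF: "X u \<in> F2" if "u \<in> U - {1}" for u
    unfolding X_def by (intro F2_closed(6) U1(1) that dF)
  have X0: "X u \<noteq> 0" if "u \<in> U - {1}" for u
    using that d0 by (simp add: X_def)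
  have Xr: "X u ^ r = u * X u" if "u \<in> U - {1}" for u
  proof -
    have "X u ^ r = (- u * (1 / (1 - u))) / (- \<delta>)"
      unfolding X_def power_divide[of _ \<delta>] U1(2)[OF that] dr ..
    then show ?thesis by (simp add: X_def)
  qed
  have fX: "X u ^ d - (X u ^ d) ^ r = h u / \<delta>\<^sup>2" if u: "u \<in> U - {1}" for u
  proof -
    have u0: "u \<noteq> 0" "u ^ r = inverse u" "u \<noteq> 1" using u U_nonzero U_power_r by auto
    have "X u * X u ^ (r - 1) = u * X u"
      using Xr[OF u] r7 by (simp flip: power_Suc)
    then have "X u ^ (r - 1) = u" using X0[OF u] by (simp add: mult.commute)
    then have f: "X u ^ d = (X u)\<^sup>2 * u ^ m"
      unfolding d power_add by (simp add: mult.commute[of m] power_mult)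
    have "(X u ^ d) ^ r = ((X u) ^ r)\<^sup>2 * (u ^ r) ^ m"
      unfolding f power_mult_distrib by (simp add: mult.commute flip: power_mult)
    then have fr: "(X u ^ d) ^ r = (X u)\<^sup>2 * u\<^sup>2 * inverse (u ^ m)"
      using Xr[OF u] u0 by (simp add: power_mult_distrib power_inverse)
    have pA: "u powi A = u ^ m / u" "u powi (- A) = u / u ^ m"
      using u0 by (simp_all add: A_def power_int_diff power_int_minus)
    have Xsq: "(X u)\<^sup>2 = 1 / ((u - 1)\<^sup>2 * \<delta>\<^sup>2)"
      by (simp add: X_def power_divide power_mult_distrib power2_commute[of 1 u])
    have "u * (u powi A - u powi (- A)) = u ^ m - u\<^sup>2 * inverse (u ^ m)"
      using u0 unfolding pA by (simp add: field_simps power2_eq_square)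
    then have "h u / \<delta>\<^sup>2 = (u ^ m - u\<^sup>2 * inverse (u ^ m)) * (X u)\<^sup>2"
      unfolding h_def Xsq by simp
    then show ?thesis unfolding fr by (simp add: f algebra_simps)
  qed
  have "X v - X w = \<delta> / \<delta>" unfolding X_def by (simp only: \<delta>_def diff_divide_distrib)
  then have "X v - X w = 1" using d0 by simp
  then have Xv: "X v = X w + 1" by (simp add: algebra_simps)
  have "X v ^ d - (X v ^ d) ^ r = X w ^ d - (X w ^ d) ^ r" using fX[OF v] fX[OF w] eq by simp
  then have "(X v ^ d - X w ^ d) ^ r = X v ^ d - X w ^ d" by (simp add: frob_r_diff algebra_simps)
  then have "(X w + 1) ^ d - X w ^ d \<in> frob_fixed r" by (simp add: frob_fixed_def Xv)
  then have "X w \<in> frob_fixed r" by (rule in_subfield_if_difference_in_subfield[OF XF[OF w]])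
  then have "w * X w = X w" using Xr[OF w] by (simp add: frob_fixed_def)
  then show False using X0[OF w] w by simp
qed

text \<open>The r distinct values of \<open>h\<close> fill the line z^r = - z, which is stable under
  scaling by units g of the field of order r; such a g is chosen with g^s other than 1.\<close>

lemma sum_h_power:
  assumes "0 < s" "s < r - 1"
  shows "(\<Sum>v\<in>U - {1}. h v ^ s) = 0"
proof -
  define Z where "Z = {z :: 'a. z ^ r = - z}"
  have "card Z \<le> r"
  proof -
    define f where "f = monom 1 r + [:0, 1 :: 'a:]"
    have "coeff f r = 1" using r7 by (simp add: f_def coeff_pCons split: nat.splits)
    then have "f \<noteq> 0" by auto
    then have "card {x. poly f x = 0} \<le> degree f" by (rule card_poly_roots_bound)
    also have "degree f \<le> r"
      unfolding f_def using r7 by (intro degree_add_le) (auto simp: degree_monom_le)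
    also have "{x. poly f x = 0} = Z" by (auto simp: f_def poly_monom Z_def eq_neg_iff_add_eq_0)
    finally show ?thesis .
  qed
  moreover have "card (h ` (U - {1})) = r"
    using card_U one_in_U by (simp add: card_image[OF h_inj] card_Diff_singleton)
  moreover have "h ` (U - {1}) \<subseteq> Z" using h_frob by (auto simp: Z_def)
  ultimately have im: "h ` (U - {1}) = Z" by (intro card_seteq) auto
  have "\<not> r - 1 dvd s" using assms by (simp add: nat_dvd_not_less)
  then obtain g :: 'a where g: "g ^ (r - 1) = 1" "g ^ s \<noteq> 1"
    using root_of_unity_power_neq_1[OF dvd_card(1), of s] r7 by auto
  have g0: "g \<noteq> 0" using g r7 by (auto simp: zero_power)
  have gr: "g ^ r = g" using frob_fixed_eq[of r] g r7 by (auto simp: frob_fixed_def)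
  have "(\<Sum>z\<in>Z. z ^ s) = (\<Sum>z\<in>Z. (g * z) ^ s)"
    by (rule sum.reindex_bij_witness[of _ "\<lambda>x. g * x" "\<lambda>x. x / g"])
       (use gr g0 in \<open>auto simp: power_mult_distrib power_divide Z_def\<close>)
  also have "\<dots> = g ^ s * (\<Sum>z\<in>Z. z ^ s)"
    by (simp add: power_mult_distrib sum_distrib_left)
  finally have "(1 - g ^ s) * (\<Sum>z\<in>Z. z ^ s) = 0" by (simp add: left_diff_distrib)
  then have "(\<Sum>z\<in>Z. z ^ s) = 0" using g by simp
  then show ?thesis unfolding im[symmetric] by (simp add: sum.reindex[OF h_inj])
qed

lemma moment_vanishes:
  assumes "1 \<le> t" "4 * t + 2 \<le> r"
  shows "int p dvd moment (int r + 1) (2 * A) t"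
proof -
  let ?c = "\<lambda>i. of_nat ((2 * t) choose i) * (-1) ^ i :: 'a"
  let ?e = "\<lambda>i. 2 * int t + A * (2 * int i - 2 * int t)"
  have hpow: "h v ^ (2 * t) = (\<Sum>i\<le>2 * t. ?c i * (v powi ?e i / (v - 1) ^ (4 * t)))" if v: "v \<in> U - {1}" for v
  proof -
    have v0: "v \<noteq> 0" using v U_nonzero by auto
    have "(v powi A - v powi (- A)) ^ (2 * t)
        = (\<Sum>i\<le>2 * t. of_nat ((2 * t) choose i) * (v powi A) ^ i * (- (v powi (- A))) ^ (2 * t - i))"
      using binomial_ring[of "v powi A" "- (v powi (- A))" "2 * t"] by simp
    also have "\<dots> = (\<Sum>i\<le>2 * t. ?c i * v powi (A * (2 * int i - 2 * int t)))"
    proof (rule sum.cong[OF refl])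
      fix i assume i: "i \<in> {..2 * t}"
      have "(- (v powi (- A))) ^ (2 * t - i) = (-1) ^ (2 * t - i) * (v powi (- A)) ^ (2 * t - i)"
        by (rule power_minus)
      moreover have "(-1 :: 'a) ^ (2 * t - i) = (-1) ^ i" using i by (simp add: uminus_power_if)
      moreover have "(v powi A) ^ i * (v powi (- A)) ^ (2 * t - i) = v powi (A * (2 * int i - 2 * int t))"
      proof -
        have "(v powi A) ^ i * (v powi (- A)) ^ (2 * t - i) = v powi (A * int i + (- A) * int (2 * t - i))"
          using v0 unfolding power_int_power' by (simp only: power_int_add simp_thms)
        also have "A * int i + (- A) * int (2 * t - i) = A * (2 * int i - 2 * int t)"
          using i by (simp add: of_nat_diff algebra_simps)
        finally show ?thesis .
      qed
      ultimately show "of_nat ((2 * t) choose i) * (v powi A) ^ i * (- (v powi (- A))) ^ (2 * t - i)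
          = ?c i * v powi (A * (2 * int i - 2 * int t))" by (simp add: mult_ac)
    qed
    finally have "h v ^ (2 * t) = v ^ (2 * t) * (\<Sum>i\<le>2 * t. ?c i * v powi (A * (2 * int i - 2 * int t))) / (v - 1) ^ (4 * t)"
      by (simp add: h_def power_mult_distrib power_divide flip: power_mult)
    also have "\<dots> = (\<Sum>i\<le>2 * t. ?c i * (v powi ?e i / (v - 1) ^ (4 * t)))"
    proof -
      have "v powi ?e i = v ^ (2 * t) * v powi (A * (2 * int i - 2 * int t))" for i
      proof -
        have "v ^ (2 * t) = v powi (2 * int t)" by (metis of_nat_mult of_nat_numeral power_int_of_nat)
        then show ?thesis using v0 by (simp only: power_int_add simp_thms)
      qed
      then show ?thesis by (simp add: sum_distrib_left sum_divide_distrib mult_ac)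
    qed
    finally show ?thesis .
  qed
  have "0 = (\<Sum>v\<in>U - {1}. h v ^ (2 * t))" using assms by (intro sum_h_power[symmetric]) auto
  also have "\<dots> = (\<Sum>v\<in>U - {1}. \<Sum>i\<le>2 * t. ?c i * (v powi ?e i / (v - 1) ^ (4 * t)))"
    by (intro sum.cong refl hpow)
  also have "\<dots> = (\<Sum>i\<le>2 * t. \<Sum>v\<in>U - {1}. ?c i * (v powi ?e i / (v - 1) ^ (4 * t)))"
    by (rule sum.swap)
  also have "\<dots> = (\<Sum>i\<le>2 * t. ?c i * T (4 * t) (?e i))"
    by (simp add: T_def sum_distrib_left)
  also have "\<dots> = - (\<Sum>i\<le>2 * t. ?c i * of_nat (nat ((?e i - 1) mod (int r + 1)) choose (4 * t)))"
    using assms by (simp add: T_eq_choose sum_negf)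
  also have "(\<Sum>i\<le>2 * t. ?c i * of_nat (nat ((?e i - 1) mod (int r + 1)) choose (4 * t)))
      = of_int (moment (int r + 1) (2 * A) t)"
    unfolding moment_def moment_term_def of_int_sum
    by (rule sum.reindex_bij_witness[of _ "\<lambda>k. nat (k + int t)" "\<lambda>i. int i - int t"])
       (auto simp: algebra_simps)
  finally have "of_int (moment (int r + 1) (2 * A) t) = (0 :: 'a)" by simp
  then show ?thesis by (simp add: of_int_eq_0)
qed

end

section \<open>Symmetries of the moments and the moment for t = 1\<close>

lemma moment_cong:
  assumes "[b = b'] (mod n)"
  shows "moment n b t = moment n b' t"
proof -
  have "(2 * int t - 1 + b * k) mod n = (2 * int t - 1 + b' * k) mod n" for k
    using cong_add[OF cong_refl cong_scalar_right[OF assms, of k], of "2 * int t - 1"] by (simp add: cong_def)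
  then show ?thesis by (simp add: moment_def moment_term_def)
qed

lemma moment_minus: "moment n (- b) t = moment n b t"
  unfolding moment_def
proof (rule sum.reindex_bij_witness[of _ uminus uminus])
  fix k assume k: "k \<in> {- int t..int t}"
  have eq: "nat (- k + int t) = 2 * t - nat (k + int t)" using k by auto
  have "nat (k + int t) \<le> 2 * t" using k by auto
  then have "(2 * t) choose nat (- k + int t) = (2 * t) choose nat (k + int t)"
    unfolding eq by (simp add: binomial_symmetric[symmetric])
  moreover have "(-1 :: int) ^ nat (- k + int t) = (-1) ^ nat (k + int t)"
    unfolding eq using \<open>nat (k + int t) \<le> 2 * t\<close> by (simp add: uminus_power_if)
  ultimately show "moment_term n b t (- k) = moment_term n (- b) t k"
    by (simp add: moment_term_def)
qed auto

lemma choose_4_mult_24: "24 * int (x choose 4) = int x * (int x - 1) * (int x - 2) * (int x - 3)"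
proof -
  have "24 * real (x choose 4) = real x * (real x - 1) * (real x - 2) * (real x - 3)"
    unfolding binomial_gbinomial gbinomial_prod_rev
    by (simp add: eval_nat_numeral fact_num_eq_if)
  then have "real_of_int (24 * int (x choose 4)) = real_of_int (int x * (int x - 1) * (int x - 2) * (int x - 3))"
    by simp
  then show ?thesis by (simp only: of_int_eq_iff)
qed

text \<open>The term k = 0 is 0, and modulo \<open>p\<close>, where r is 0, 24 times each of the
  terms k = 1 and k = -1 is the same product in b.\<close>

lemma moment_1_dvd:
  fixes p :: nat and b r :: int
  assumes p: "prime p" "p > 5" and r: "int p dvd r" "r > 1" and b: "2 \<le> b" "b \<le> r - 1"
    and dvd: "int p dvd moment (r + 1) b 1"
  shows "int p dvd (b + 1) * b * (b - 1) * (b - 2)"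
proof -
  have set: "{- int 1..int 1} = {-1, 0, 1}" by auto
  have "(1 - b) mod (r + 1) = (1 - b + (r + 1)) mod (r + 1)" by (simp only: mod_add_self2)
  also have "\<dots> = r + 2 - b" using b by (subst mod_pos_pos_trivial) auto
  finally have K: "(1 - b) mod (r + 1) = r + 2 - b" "(1 + b) mod (r + 1) = 1 + b" "1 mod (r + 1) = 1"
    using b r by auto
  have "moment (r + 1) b 1 = int (nat (r + 2 - b) choose 4) + int (nat (1 + b) choose 4)"
    unfolding moment_def moment_term_def set using K by (simp add: numeral_2_eq_2[symmetric])
  then have "24 * moment (r + 1) b 1
      = (r + 2 - b) * (r + 1 - b) * (r - b) * (r - 1 - b) + (b + 1) * b * (b - 1) * (b - 2)"
    using choose_4_mult_24[of "nat (r + 2 - b)"] choose_4_mult_24[of "nat (1 + b)"] b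
    by (simp add: algebra_simps)
  moreover have "[(r + 2 - b) * (r + 1 - b) * (r - b) * (r - 1 - b)
      = (0 + 2 - b) * (0 + 1 - b) * (0 - b) * (0 - 1 - b)] (mod int p)"
    using r(1) by (intro cong_mult cong_add cong_diff cong_refl) (auto simp: cong_0_iff)
  moreover have "(0 + 2 - b) * (0 + 1 - b) * (0 - b) * (0 - 1 - b) = (b + 1) * b * (b - 1) * (b - 2)"
    by (simp add: algebra_simps)
  ultimately have "[24 * moment (r + 1) b 1 = (b + 1) * b * (b - 1) * (b - 2) + (b + 1) * b * (b - 1) * (b - 2)] (mod int p)"
    by (metis cong_add cong_refl)
  moreover have "int p dvd 24 * moment (r + 1) b 1" using dvd by simp
  ultimately have "int p dvd 2 * ((b + 1) * b * (b - 1) * (b - 2))"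
    using cong_dvd_iff by (metis mult_2)
  moreover have "\<not> int p dvd 2" using p(2) by (auto dest: zdvd_imp_le)
  ultimately show ?thesis using p(1) by (metis prime_dvd_mult_iff prime_nat_int_transfer)
qed

section \<open>Excluding the quadratic twist\<close>

context quadratic_step
begin

text \<open>The monomial is x^2 times the quadratic character. The sum of the squared differences is
  0; in its expansion only the cross term remains, and in that a single power sum. So (g + 2) choose
  4 would be 0 modulo \<open>p\<close>, while it is 9 / 384 because 2 g = -1.\<close>

lemma half_twist_not_planar:
  assumes inj: "inj_on (\<lambda>x :: 'a. (x + 1) ^ d - x ^ d) (frob_fixed (r\<^sup>2))"
    and d: "[d = 2 + g] (mod r\<^sup>2 - 1)" "d > 0" and g: "r\<^sup>2 - 1 = 2 * g"
  shows False
proof -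
  have "7 * 7 \<le> r * r" using r7 by (intro mult_mono) auto
  then have r49: "r\<^sup>2 \<ge> 49" by (simp add: power2_eq_square)
  then have g24: "g \<ge> 24" using g by linarith
  have R1: "r\<^sup>2 > 1" using r49 by linarith
  define e where "e = 2 + g"
  have pw: "x ^ d = x ^ e" if "x \<in> F2" for x
    using that d R1 unfolding F2_def e_def by (intro power_frob_fixed_cong[of _ "r\<^sup>2"]) auto
  have S: "(\<Sum>x\<in>F2. x ^ k) = (if 2 * g dvd k then -1 else 0)" if "k > 0" for k
  proof -
    have "of_nat (r\<^sup>2 - 1) = (-1 :: 'a)" using R1 of_nat_r by (simp add: of_nat_diff)
    then show ?thesis using sum_frob_fixed[OF R1 r2 that] unfolding F2_def g by simp
  qed
  have "(\<Sum>x\<in>F2. ((x + 1) ^ d - x ^ d)\<^sup>2) = 0"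
    using sum_difference_power[OF r_square R1 r2 inj, of 0 1 2] F2_closed(1,2) r49 unfolding F2_def by simp
  moreover have "(\<Sum>x\<in>F2. ((x + 1) ^ d - x ^ d)\<^sup>2) = (\<Sum>x\<in>F2. (x + 1) ^ (2 * e) + x ^ (2 * e) - 2 * (x ^ e * (x + 1) ^ e))"
  proof (rule sum.cong[OF refl])
    fix x assume x: "x \<in> F2"
    have "((x + 1) ^ d - x ^ d)\<^sup>2 = ((x + 1) ^ e - x ^ e)\<^sup>2" using pw[OF x] pw[OF F2_closed(3)[OF x F2_closed(2)]] by simp
    also have "\<dots> = (x + 1) ^ (2 * e) + x ^ (2 * e) - 2 * (x ^ e * (x + 1) ^ e)"
    proof -
      have sq: "(a - b)\<^sup>2 = a * a + b * b - 2 * (b * a)" for a b :: 'a by (simp add: power2_eq_square algebra_simps)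
      show ?thesis unfolding sq[of "(x + 1) ^ e" "x ^ e"] by (simp only: mult_2 power_add)
    qed
    finally show "((x + 1) ^ d - x ^ d)\<^sup>2 = (x + 1) ^ (2 * e) + x ^ (2 * e) - 2 * (x ^ e * (x + 1) ^ e)" .
  qed
  moreover have "\<dots> = (\<Sum>x\<in>F2. (x + 1) ^ (2 * e)) + (\<Sum>x\<in>F2. x ^ (2 * e)) - 2 * (\<Sum>x\<in>F2. x ^ e * (x + 1) ^ e)"
    by (simp add: sum.distrib sum_subtractf sum_distrib_left)
  moreover have "(\<Sum>x\<in>F2. (x + 1) ^ (2 * e)) = (\<Sum>x\<in>F2. x ^ (2 * e))"
    by (rule sum.reindex_bij_witness[of _ "\<lambda>x. x - 1" "\<lambda>x. x + 1"]) (auto simp: F2_closed(2,3,4))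
  moreover have "(\<Sum>x\<in>F2. x ^ (2 * e)) = 0"
  proof -
    have "\<not> 2 * g dvd 2 * e"
    proof
      assume "2 * g dvd 2 * e"
      then have "g dvd 2 + g" unfolding e_def by (simp only: nat_mult_dvd_cancel1[of 2] zero_less_numeral)
      then have "g dvd 2" by (simp only: dvd_add_triv_right_iff)
      then show False using g24 by (auto dest: dvd_imp_le)
    qed
    then show ?thesis using S[of "2 * e"] by (simp add: e_def)
  qed
  ultimately have "(\<Sum>x\<in>F2. x ^ e * (x + 1) ^ e) = 0" using two_nonzero by simp
  moreover have "(\<Sum>x\<in>F2. x ^ e * (x + 1) ^ e) = (\<Sum>l\<le>e. of_nat (e choose l) * (\<Sum>x\<in>F2. x ^ (e + l)))"
  proof -
    have "x ^ e * (x + 1) ^ e = (\<Sum>l\<le>e. of_nat (e choose l) * x ^ (e + l))" for x :: 'a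
      unfolding binomial_ring[of x 1 e] by (simp add: sum_distrib_left power_add mult_ac)
    then show ?thesis by (simp add: sum.swap[of _ F2] sum_distrib_left)
  qed
  moreover have "\<dots> = (\<Sum>l\<le>e. if l = g - 2 then - of_nat (e choose l) else 0)"
  proof (rule sum.cong[OF refl])
    fix l assume l: "l \<in> {..e}"
    \<comment> \<open>The exponent e + l is positive and at most 2 e = 2 g + 4 < 4 g, so the only
      multiple of 2 g it can be is 2 g.\<close>
    have "2 * g dvd e + l \<longleftrightarrow> l = g - 2"
    proof
      assume "2 * g dvd e + l"
      then obtain c where c: "e + l = 2 * g * c" by auto
      have "c < 2"
      proof (rule ccontr)
        assume "\<not> c < 2"
        then have "2 * g * 2 \<le> 2 * g * c" by (intro mult_le_mono2) auto
        moreover have "l \<le> e" using l by simp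
        ultimately show False using c g24 unfolding e_def by linarith
      qed
      moreover have "c \<noteq> 0" using c by (intro notI) (simp add: e_def)
      ultimately have "c = 1" by linarith
      then show "l = g - 2" using c by (simp add: e_def)
    next
      assume "l = g - 2"
      then have "e + l = 2 * g" using g24 by (simp add: e_def)
      then show "2 * g dvd e + l" by simp
    qed
    then show "of_nat (e choose l) * (\<Sum>x\<in>F2. x ^ (e + l)) = (if l = g - 2 then - of_nat (e choose l) else 0)"
      using S[of "e + l"] by (simp add: e_def)
  qed
  moreover have "\<dots> = - of_nat (e choose (g - 2))"
  proof -
    have "g - 2 \<le> e" by (simp add: e_def)
    then show ?thesis by simp
  qed
  ultimately have "p dvd (e choose (g - 2))" by (simp add: of_nat_eq_0)
  moreover have "e choose (g - 2) = e choose 4"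
    using binomial_symmetric[of 4 e] g24 by (simp add: e_def)
  ultimately have "int p dvd int (e choose 4)" by simp
  \<comment> \<open>The factor 16 turns each g into 2 g, which is -1 modulo
    \<open>p\<close>.\<close>
  then have "int p dvd 16 * (24 * int (e choose 4))" by simp
  also have "16 * (24 * int (e choose 4)) = (2 * int g + 4) * (2 * int g + 2) * (2 * int g) * (2 * int g - 2)"
    unfolding choose_4_mult_24 by (simp add: e_def algebra_simps)
  finally have "int p dvd (2 * int g + 4) * (2 * int g + 2) * (2 * int g) * (2 * int g - 2)" .
  moreover have "[(2 * int g + 4) * (2 * int g + 2) * (2 * int g) * (2 * int g - 2)
      = (-1 + 4) * (-1 + 2) * (-1) * (-1 - 2)] (mod int p)"
  proof -
    have "int p dvd int r" using N r by simp
    then have "int p dvd (int r)\<^sup>2" by (simp add: power2_eq_square)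
    moreover have "2 * int g = (int r)\<^sup>2 - 1"
    proof -
      have "int (r\<^sup>2 - 1) = int (r\<^sup>2) - 1" using R1 by (simp add: of_nat_diff)
      then show ?thesis unfolding g by simp
    qed
    ultimately have "[2 * int g = -1] (mod int p)" by (simp add: cong_iff_dvd_diff)
    then show ?thesis by (intro cong_mult cong_add cong_diff cong_refl)
  qed
  ultimately have "int p dvd (-1 + 4) * (-1 + 2) * (-1) * (-1 - 2)" using cong_dvd_iff by blast
  then have "int p dvd 9" by simp
  then have "p dvd 9" by (metis int_dvd_int_iff of_nat_numeral)
  then have "p dvd 3 * 3" by simp
  then have "p dvd 3" using prime_p by (simp only: prime_dvd_mult_iff) simp
  then show False using p5 by (auto dest: dvd_imp_le)
qed

end

section \<open>The exponent over the quadratic extension\<close>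

context planar_step
begin

lemma exponent_cong_half: "int r + 1 dvd 2 * A - 2 \<or> int r + 1 dvd 2 * A + 2"
proof -
  define n where "n = int r + 1"
  define b where "b = (2 * A) mod n"
  have n0: "n > 1" "even n" using r7 odd_r by (auto simp: n_def)
  have bb: "0 \<le> b" "b < n" "even b" using n0 by (auto simp: b_def dvd_mod_iff)
  have bA: "[b = 2 * A] (mod n)" by (simp add: b_def cong_def)
  have b0: "b \<noteq> 0"
  proof
    assume "b = 0"
    have "h v = 0" if "v \<in> U - {1}" for v
    proof -
      have "v powi (2 * A) = 1" using U_powi_mod[of v "2 * A"] that \<open>b = 0\<close> by (simp add: b_def n_def)
      moreover have "v powi A = v powi (2 * A + - A)" by simp
      moreover have "v powi (2 * A + - A) = v powi (2 * A) * v powi (- A)"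
        using that U_nonzero by (intro power_int_add) auto
      ultimately have "v powi A = v powi (- A)" by simp
      then show ?thesis by (simp add: h_def)
    qed
    then have "h ` (U - {1}) \<subseteq> {0}" by auto
    then have "card (h ` (U - {1})) \<le> card {0 :: 'a}" by (intro card_mono) auto
    then show False using card_U one_in_U r7 by (simp add: card_image[OF h_inj] card_Diff_singleton)
  qed
  have b2: "2 \<le> b" "b \<le> n - 2"
  proof -
    have "b \<noteq> 1" "b \<noteq> n - 1" using bb n0 by auto
    then show "2 \<le> b" "b \<le> n - 2" using bb b0 by linarith+
  qed
  have van: "int p dvd moment n c t" if "1 \<le> t" "4 * t + 2 \<le> r" "[c = 2 * A] (mod n) \<or> [c = - (2 * A)] (mod n)" for c t
    using moment_vanishes[OF that(1,2)] that(3) moment_cong moment_minus unfolding n_def by metis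
  have pr: "int p dvd int r" using r N by simp
  have "int p dvd (b + 1) * b * (b - 1) * (b - 2)"
    using van[of 1 b] bA r7 b2 pr unfolding n_def
    by (intro moment_1_dvd[OF prime_p p5, of "int r"]) auto
  then have "int p dvd b + 1 \<or> int p dvd b \<or> int p dvd b - 1 \<or> int p dvd b - 2"
    using prime_p by (simp add: prime_dvd_mult_iff) 
  \<comment> \<open>The moment for t = 1 leaves b = -1, 0, 1, 2 modulo \<open>p\<close>; since n is
    1 modulo \<open>p\<close>, passing to n - b sends -1 to 2 and 1 to 0.\<close>
  then obtain c where c: "c = b \<or> c = n - b" "int p dvd c \<or> int p dvd c - 2"
  proof (elim disjE)
    assume "int p dvd b + 1"
    then have "int p dvd int r - (b + 1)" using pr by simp
    then show ?thesis using that[of "n - b"] by (simp add: n_def algebra_simps)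
  next
    assume "int p dvd b - 1"
    then have "int p dvd int r - (b - 1)" using pr by (rule dvd_diff[rotated])
    then show ?thesis using that[of "n - b"] by (simp add: n_def algebra_simps)
  qed (use that[of b] in auto)
  have cA: "[c = 2 * A] (mod n) \<or> [c = - (2 * A)] (mod n)"
  proof (cases "c = b")
    case False
    then have "c = n - b" using c by simp
    moreover have "[n - b = 0 - 2 * A] (mod n)" using bA by (intro cong_diff) (auto simp: cong_def)
    ultimately show ?thesis by simp
  qed (use bA in simp)
  have c2: "2 \<le> c" "c \<le> n - 2" "even c" using c(1) b2 bb n0 by auto
  define a where "a = nat (c div 2)"
  have a: "2 * int a = c" using c2 by (simp add: a_def)
  have "p dvd a \<or> p dvd a - 1"
  proof -
    have "\<not> int p dvd 2" using p5 by (auto dest: zdvd_imp_le)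
    moreover have "prime (int p)" using prime_p by simp
    moreover have "int p dvd 2 * int a \<or> int p dvd 2 * (int a - 1)" using c(2) a by (simp add: algebra_simps)
    ultimately have "int p dvd int a \<or> int p dvd int a - 1" by (metis prime_dvd_mult_iff)
    moreover have "int a - 1 = int (a - 1)" using a c2 by auto
    ultimately show ?thesis by (metis int_dvd_int_iff)
  qed
  moreover have "1 \<le> a" using a c2 by auto
  moreover have "2 * a < p ^ N + 1"
  proof -
    have "int (2 * a) < int (p ^ N + 1)" using a c2(2) unfolding n_def r by simp
    then show ?thesis by (simp only: of_nat_less_iff)
  qed
  moreover have "int p dvd moment (int (p ^ N) + 1) (2 * int a) t" if "1 \<le> t" "4 * t + 2 \<le> p ^ N" for t
    using van[of t c] that cA unfolding a n_def r by blast
  ultimately have "a = 1" by (intro moments_vanish_imp_eq_1[OF prime_p p5, of a N])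
  then have "c = 2" using a by simp
  then have "n dvd 2 - 2 * A \<or> n dvd 2 + 2 * A" using cA by (simp add: cong_iff_dvd_diff)
  then show ?thesis unfolding n_def by (metis add.commute dvd_diff_commute)
qed

text \<open>The previous congruence determines d modulo g = (r^2 - 1)/2 as 2 or 2 r. Modulo 2 g this
  leaves in addition the two twists by g, which are excluded.\<close>

lemma exponent_cong: "[d = 2] (mod r\<^sup>2 - 1) \<or> [d = 2 * r] (mod r\<^sup>2 - 1)"
proof -
  define H where "H = (int r + 1) div 2"
  have H: "int r + 1 = 2 * H" unfolding H_def by (rule dvd_mult_div_cancel[symmetric]) (use odd_r in simp)
  define g where "g = (r\<^sup>2 - 1) div 2"
  have g: "r\<^sup>2 - 1 = 2 * g" using odd_r by (simp add: g_def)
  have R: "int (r\<^sup>2 - 1) = 2 * int g" using g by simp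
  have "int (r\<^sup>2 - 1) = (int r - 1) * (int r + 1)"
    unfolding square_minus_1 using r7 by (simp add: of_nat_diff algebra_simps)
  then have gH: "int g = H * (int r - 1)" using R H by (simp add: mult.commute)
  have dI: "int d = 2 + int m * (int r - 1)" using d r7 by (simp add: of_nat_diff)
  have toI: "[d = c] (mod r\<^sup>2 - 1) \<longleftrightarrow> 2 * int g dvd int d - int c" for c
    by (metis R cong_iff_dvd_diff cong_int_iff)
  have par: "2 * int g dvd q * int g \<or> 2 * int g dvd q * int g - int g" for q :: int
  proof (cases "even q")
    case True
    then obtain q' where "q = 2 * q'" by auto
    then show ?thesis by simp
  next
    case False
    then obtain q' where "q = 2 * q' + 1" by (auto elim: oddE)
    then have "q * int g - int g = 2 * int g * q'" by (simp add: algebra_simps)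
    then show ?thesis by simp
  qed
  have tw0: "\<not> [d = 2 + g] (mod r\<^sup>2 - 1)"
    using half_twist_not_planar[OF inj _ _ g] d by auto
  \<comment> \<open>Multiplying by r, that is, composing with x^r, carries 2 r + g to 2 + g, because
    g (r - 1) is a multiple of 2 g.\<close>
  have tw1: "\<not> [d = 2 * r + g] (mod r\<^sup>2 - 1)"
  proof
    assume "[d = 2 * r + g] (mod r\<^sup>2 - 1)"
    then have "[d * p ^ N = (2 * r + g) * r] (mod r\<^sup>2 - 1)" unfolding r[symmetric] by (rule cong_scalar_right)
    also have "[(2 * r + g) * r = 2 + g] (mod r\<^sup>2 - 1)"
    proof -
      have "int ((2 * r + g) * r) - int (2 + g) = 2 * int (r\<^sup>2 - 1) + int g * (int r - 1)"
        using r7 by (simp add: of_nat_diff algebra_simps power2_eq_square)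
      also have "\<dots> = (2 * int g) * (2 + (H - 1))"
      proof -
        have rH: "int r = 2 * H - 1" using H by simp
        show ?thesis unfolding R rH by (simp add: algebra_simps)
      qed
      finally show ?thesis by (metis R cong_iff_dvd_diff cong_int_iff dvd_triv_left)
    qed
    finally show False
      using half_twist_not_planar[OF planar_exponent_frob[OF inj, of N] _ _ g] d prime_gt_0_nat[OF prime_p] by simp
  qed
  from exponent_cong_half have "H dvd A - 1 \<or> H dvd A + 1"
  proof (elim disjE)
    assume "int r + 1 dvd 2 * A - 2"
    then have "2 * H dvd 2 * (A - 1)" unfolding H right_diff_distrib by simp
    then have "H dvd A - 1" unfolding dvd_mult_cancel_left by simp
    then show ?thesis ..
  next
    assume "int r + 1 dvd 2 * A + 2"
    then have "2 * H dvd 2 * (A + 1)" unfolding H distrib_left by simp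
    then have "H dvd A + 1" unfolding dvd_mult_cancel_left by simp
    then show ?thesis ..
  qed
  then show ?thesis
  proof
    assume "H dvd A - 1"
    then obtain q where "int m - 2 = H * q" by (auto simp: A_def)
    then have "int m = 2 + H * q" by simp
    then have "int d - int (2 * r) = q * int g" unfolding dI gH by (simp add: algebra_simps)
    then show ?thesis using par[of q] tw1 unfolding toI by (auto simp: algebra_simps)
  next
    assume "H dvd A + 1"
    then obtain q where "int m = H * q" by (auto simp: A_def)
    then have "int d - int 2 = q * int g" unfolding dI gH by (simp add: algebra_simps)
    then show ?thesis using par[of q] tw0 unfolding toI by (auto simp: algebra_simps)
  qed
qed

end

section \<open>Climbing the tower\<close>

context prime_power_field
begin

lemma planar_exponent:
  assumes p5: "p > 5" and dvd: "p ^ (2 ^ l) - 1 dvd p ^ n - 1"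
    and inj: "inj_on (\<lambda>x :: 'a. (x + 1) ^ d - x ^ d) (frob_fixed (p ^ (2 ^ l)))"
  shows "\<exists>i. [d = 2 * p ^ i] (mod p ^ (2 ^ l) - 1)"
  using dvd inj
proof (induction l)
  case 0
  then have "[d = 2 * p ^ 0] (mod p ^ (2 ^ 0) - 1)"
    using planar_exponent_prime_field[OF p5, of d] by simp
  then show ?case ..
next
  case (Suc l)
  define N where "N = (2 :: nat) ^ l"
  define r where "r = p ^ N"
  have R: "p ^ (2 ^ Suc l) = r\<^sup>2" by (simp add: r_def N_def mult.commute flip: power_mult)
  interpret Q: quadratic_step p n ty N r
  proof unfold_locales
    show "p > 5" by (rule p5)
    show "N > 0" by (simp add: N_def)
    show "r = p ^ N" by (rule r_def)
    show "r\<^sup>2 - 1 dvd p ^ n - 1" using Suc.prems(1) unfolding R .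
  qed
  have inj2: "inj_on (\<lambda>x :: 'a. (x + 1) ^ d - x ^ d) (frob_fixed (r\<^sup>2))" using Suc.prems(2) unfolding R .
  have "inj_on (\<lambda>x :: 'a. (x + 1) ^ d - x ^ d) (frob_fixed r)"
    by (rule inj_on_subset[OF inj2]) (use Q.Fr_subset in \<open>simp add: Q.F2_def\<close>)
  then obtain i where i: "[d = 2 * p ^ i] (mod r - 1)"
    using Suc.IH Q.dvd_card(1) unfolding r_def N_def by blast
  have period: "[c ^ k = 1] (mod c - 1)" if "c > 0" for c k :: nat
  proof -
    have "[c = 1] (mod c - 1)" using that by (simp add: cong_altdef_nat)
    then show ?thesis using cong_pow[of c 1 "c - 1" k] by simp
  qed
  have N1: "N \<ge> 1" by (simp add: N_def)
  \<comment> \<open>The factor p^j completes p^i to a power of r, which is 1 modulo r - 1, so the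
    exponent becomes 2 there.\<close>
  define j where "j = (N - 1) * i"
  have "i + j = N * i" using N1 by (simp add: j_def diff_mult_distrib)
  then have pij: "p ^ i * p ^ j = r ^ i" by (simp add: r_def flip: power_add power_mult)
  have "[d * p ^ j = 2 * p ^ i * p ^ j] (mod r - 1)" by (rule cong_scalar_right[OF i])
  also have "2 * p ^ i * p ^ j = 2 * r ^ i" using pij by simp
  also have "[2 * r ^ i = 2 * 1] (mod r - 1)" using Q.r7 by (intro cong_scalar_left period) auto
  finally have d2: "[d * p ^ j = 2] (mod r - 1)" by simp
  have "(d * p ^ j) mod (r - 1) = 2" using d2 Q.r7 by (simp add: cong_def)
  then have dm: "d * p ^ j = 2 + (d * p ^ j) div (r - 1) * (r - 1)" by (metis add.commute div_mult_mod_eq)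
  interpret S: planar_step p n ty N r "d * p ^ j" "(d * p ^ j) div (r - 1)"
    by unfold_locales (rule planar_exponent_frob[OF inj2], rule dm)
  have "\<exists>e. [d * p ^ j = 2 * p ^ e] (mod r\<^sup>2 - 1)"
    using S.exponent_cong unfolding r_def[symmetric] by (metis mult.right_neutral power_0 r_def)
  then obtain e where e: "[d * p ^ j = 2 * p ^ e] (mod r\<^sup>2 - 1)" ..
  \<comment> \<open>The factor p^j' completes p^j to a power of r^2 and so undoes the normalisation
    modulo r^2 - 1.\<close>
  define j' where "j' = (2 * N - 1) * j"
  have "j + j' = 2 * N * j" using N1 by (simp add: j'_def diff_mult_distrib)
  then have "p ^ j * p ^ j' = p ^ (2 * N * j)" by (simp flip: power_add)
  also have "\<dots> = (r\<^sup>2) ^ j" by (simp add: r_def mult_ac flip: power_mult)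
  finally have pjj: "p ^ j * p ^ j' = (r\<^sup>2) ^ j" .
  have "[d * 1 = d * (r\<^sup>2) ^ j] (mod r\<^sup>2 - 1)"
    using Q.r7 by (intro cong_scalar_left cong_sym[OF period]) simp
  also have "d * (r\<^sup>2) ^ j = d * p ^ j * p ^ j'" using pjj by simp
  also have "[\<dots> = 2 * p ^ e * p ^ j'] (mod r\<^sup>2 - 1)" by (rule cong_scalar_right[OF e])
  also have "2 * p ^ e * p ^ j' = 2 * p ^ (e + j')" by (simp add: power_add)
  finally have "[d = 2 * p ^ (e + j')] (mod r\<^sup>2 - 1)" by simp
  then show ?case unfolding R ..
qed

lemma planar_monom_iff:
  assumes p5: "p > 5" and n: "n = 2 ^ k"
  shows "planar (monom 1 d :: 'a poly) \<longleftrightarrow> (\<exists>i. [d = 2 * p ^ i] (mod p ^ n - 1))"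
proof
  assume "planar (monom 1 d :: 'a poly)"
  then have "bij (\<lambda>x :: 'a. poly (monom 1 d) (x + 1) - poly (monom 1 d) x - poly (monom 1 d) 1)"
    unfolding planar_def by (metis zero_neq_one)
  then have inj: "inj (\<lambda>x :: 'a. (x + 1) ^ d - x ^ d - 1)"
    by (simp add: poly_monom bij_is_inj)
  have "inj_on (\<lambda>x :: 'a. (x + 1) ^ d - x ^ d) (frob_fixed (p ^ n))"
  proof (rule inj_onI)
    fix x y :: 'a assume "(x + 1) ^ d - x ^ d = (y + 1) ^ d - y ^ d"
    then have "(x + 1) ^ d - x ^ d - 1 = (y + 1) ^ d - y ^ d - 1" by simp
    then show "x = y" by (rule injD[OF inj])
  qed
  then show "\<exists>i. [d = 2 * p ^ i] (mod p ^ n - 1)"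
    using planar_exponent[OF p5, of k d] unfolding n by simp
next
  assume "\<exists>i. [d = 2 * p ^ i] (mod p ^ n - 1)"
  then obtain i where i: "[d = 2 * p ^ i] (mod p ^ n - 1)" ..
  have n0: "n > 0" by (simp add: n)
  have P7: "p ^ n \<ge> 7" using prime_power_ge_7[OF prime_p p5 n0] .
  have two: "(2 :: 'a) \<noteq> 0"
  proof -
    have "of_nat 2 \<noteq> (0 :: 'a)" using p5 by (auto simp only: of_nat_eq_0 dest!: dvd_imp_le)
    then show ?thesis by simp
  qed
  \<comment> \<open>Since 0^0 = 1, the case x = 0 below needs d to be positive; d = 0 would make p^n
    - 1 divide 2.\<close>
  have d0: "d > 0"
  proof (rule ccontr)
    assume "\<not> d > 0"
    then have "p ^ n - 1 dvd 2 * p ^ i" using i by (simp add: cong_def dvd_eq_mod_eq_0)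
    moreover have "coprime (p ^ n - 1) (p ^ i)"
    proof -
      have "\<not> p dvd p ^ n - 1"
      proof
        assume "p dvd p ^ n - 1"
        moreover have "p dvd p ^ n" using n0 by simp
        ultimately have "p dvd p ^ n - (p ^ n - 1)" by (rule dvd_diff_nat[rotated])
        then show False using P7 p5 by simp
      qed
      then have "coprime p (p ^ n - 1)" using prime_p by (rule prime_imp_coprime[rotated])
      then show ?thesis by (simp add: coprime_commute)
    qed
    ultimately have "p ^ n - 1 dvd 2" by (simp add: coprime_dvd_mult_left_iff)
    then show False using P7 by (auto dest: dvd_imp_le)
  qed
  have pw: "x ^ d = (x\<^sup>2) ^ (p ^ i)" for x :: 'a
  proof (cases "x = 0")
    case True
    then show ?thesis using d0 prime_gt_0_nat[OF prime_p] by (simp add: zero_power)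
  next
    case False
    have red: "x ^ m = x ^ (m mod (p ^ n - 1))" for m
    proof -
      have "x ^ m = (x ^ (p ^ n - 1)) ^ (m div (p ^ n - 1)) * x ^ (m mod (p ^ n - 1))"
        by (simp flip: power_mult power_add)
      then show ?thesis using power_card_minus_1[OF False] by simp
    qed
    show ?thesis using red[of d] red[of "2 * p ^ i"] i by (simp add: cong_def power_mult)
  qed
  show "planar (monom 1 d :: 'a poly)"
    unfolding planar_def
  proof (intro allI impI)
    fix \<alpha> :: 'a assume "\<alpha> \<noteq> 0"
    \<comment> \<open>As x^d is a power of Frobenius applied to x^2, the difference is that map
      applied to the linear map 2 \<alpha> x.\<close>
    have eq: "poly (monom 1 d) (x + \<alpha>) - poly (monom 1 d) x - poly (monom 1 d) \<alpha> = (2 * \<alpha> * x) ^ (p ^ i)" for x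
    proof -
      have "(x + \<alpha>)\<^sup>2 - x\<^sup>2 - \<alpha>\<^sup>2 = 2 * \<alpha> * x" by (simp add: power2_eq_square algebra_simps)
      then show ?thesis unfolding poly_monom mult_1 pw by (simp only: flip: frob_diff)
    qed
    have "inj (\<lambda>x. (2 * \<alpha> * x) ^ (p ^ i))"
    proof (rule injI)
      fix x y assume "(2 * \<alpha> * x) ^ (p ^ i) = (2 * \<alpha> * y) ^ (p ^ i)"
      then have "2 * \<alpha> * x = 2 * \<alpha> * y" by (rule frob_inj)
      then show "x = y" using two \<open>\<alpha> \<noteq> 0\<close> by simp
    qed
    then show "bij (\<lambda>x. poly (monom 1 d) (x + \<alpha>) - poly (monom 1 d) x - poly (monom 1 d) \<alpha>)"
      unfolding eq by (simp add: bij_def finite_UNIV_inj_surj)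
  qed
qed

end

theorem theorem2:
  fixes k p d :: nat
  assumes "prime p" and "p > 5"
    and "CARD('a :: {field, finite}) = p ^ (2 ^ k)"
  shows "planar (monom 1 d :: 'a poly) \<longleftrightarrow>
           (\<exists>i :: nat. [d = 2 * p ^ i] (mod (p ^ (2 ^ k) - 1)))"
proof -
  interpret prime_power_field p "2 ^ k" "TYPE('a)"
    using assms by unfold_locales
  show ?thesis using planar_monom_iff[OF assms(2) refl] .
qed

end
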